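(* Let $c^{\mathrm{in}}=(c^{\mathrm{in}}_i)_{i\ge 0}\in X_{0,1}^+$. Assume that there are constants $C\ge 1$, $\mathcal{Q}\ge 1$ and non-negative numbers $q_{i,k}$ ($1\le k\le i$) such that $$\sum_{k=1}^i k(i-k+1)q_{i,k}\le \mathcal{Q}\,i\quad\text{for all } i\in\mathbb{N}_+,$$ and $$a(i,j;k)\le C(i-k+1)(j+k)q_{i,k}\quad\text{for all integers } 1\le k\le i \text{ and all } j\in\mathbb{N}_+ .$$ Then the initial value problem for the DGED system in the isolated case with initial condition $c(0)=c^{\mathrm{in}}$ has at least one global (mild) solution $c$ defined on $[0,\infty)$.
   Context: Notation: $\mathbb{N}=\{0,1,2,\dots\}$, $\mathbb{N}_+=\mathbb{N}\setminus\{0\}$. Rate coefficients: real numbers $a(p,q;k)\ge 0$ are given for all integers $p\ge1$, $q\ge 0$, $1\le k\le p$. Standing assumptions: $a(p,0;p)=0$ for all $p\in\mathbb{N}_+$; $a(k,j;k)=a(j,k;j)$ for all $j,k\in\mathbb{N}_+$; $a(i,0;k)=a(i,0;i-k)$ for all $i\in\mathbb{N}_+$, $1\le k\le i-1$. Discrete generalized exchange-driven (DGED) system, isolated case: $\dot c_i=\sum_{j=1}^4 Q_{j,i}(c)$, $i\in\mathbb{N}$, where $$Q_{1,i}(c)=\sum_{k=1}^\infty\sum_{j=0}^\infty a(i+k,j;k)c_{i+k}c_j,\qquad Q_{2,i}(c)=-\sum_{k=1}^\infty\sum_{j=k}^\infty a(j,i;k)c_jc_i,$$ $$Q_{3,i}(c)=\sum_{k=1}^i\sum_{j=k}^\infty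 a(j,i-k;k)c_jc_{i-k},\qquad Q_{4,i}(c)=-\sum_{k=1}^i\sum_{j=0}^\infty a(i,j;k)c_jc_i,$$ with $Q_{3,0}=Q_{4,0}=0$. Spaces: $X_{0,1}=\{c:\mathbb{N}\to\mathbb{R} : \|c\|:=\sum_{i=0}^\infty(1+i)|c_i|<\infty\}$, $X_{0,1}^+=\{c\in X_{0,1}: c_i\ge 0\ \forall i\}$. Mild solution: for $T\in(0,+\infty]$, a (mild) solution on $[0,T)$ with initial condition $c^{\mathrm{in}}\in X_{0,1}^+$ is a sequence of nonnegative functions $c=(c_i):[0,T)\to X_{0,1}^+$ such that for each $i\in\mathbb{N}$ and $t\in(0,T)$: (i) $c_i\in C^0([0,T))$; (ii) $Q_{j,i}(c(\cdot))\in L^1(0,t)$ for $j=1,2,3,4$; (iii) $c_i(t)=c^{\mathrm{in}}_i+\int_0^t\sum_{j=1}^4Q_{j,i}(c(s))\,ds$. *)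

theory Defs
  imports "HOL-Analysis.Analysis"
begin

text \<open>
  Rate coefficients are total functions \<open>a :: nat \<Rightarrow> nat \<Rightarrow> nat \<Rightarrow> real\<close>, where \<open>a p q k\<close> stands for
  $a(p,q;k)$. Only the values with \<open>1 \<le> k \<le> p\<close> are meaningful; nothing is assumed, and nothing
  below depends, on the others.
\<close>

definition rate_coefficients :: "(nat \<Rightarrow> nat \<Rightarrow> nat \<Rightarrow> real) \<Rightarrow> bool" where
  "rate_coefficients a \<longleftrightarrow>
     (\<forall>p q k. 1 \<le> k \<and> k \<le> p \<longrightarrow> 0 \<le> a p q k) \<and>
     (\<forall>p\<ge>1. a p 0 p = 0) \<and>
     (\<forall>j\<ge>1. \<forall>k\<ge>1. a k j k = a j k j) \<and>
     (\<forall>i\<ge>1. \<forall>k. 1 \<le> k \<and> k \<le> i - 1 \<longrightarrow> a i 0 k = a i 0 (i - k))"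

definition X01 :: "(nat \<Rightarrow> real) set" where
  "X01 = {c. summable (\<lambda>i. (1 + real i) * \<bar>c i\<bar>)}"

definition X01_plus :: "(nat \<Rightarrow> real) set" where
  "X01_plus = {c \<in> X01. \<forall>i. 0 \<le> c i}"

definition Q1 :: "(nat \<Rightarrow> nat \<Rightarrow> nat \<Rightarrow> real) \<Rightarrow> nat \<Rightarrow> (nat \<Rightarrow> real) \<Rightarrow> real" where
  "Q1 a i c = (\<Sum>\<^sub>\<infinity>k\<in>{1..}. \<Sum>\<^sub>\<infinity>j\<in>UNIV. a (i + k) j k * c (i + k) * c j)"

definition Q2 :: "(nat \<Rightarrow> nat \<Rightarrow> nat \<Rightarrow> real) \<Rightarrow> nat \<Rightarrow> (nat \<Rightarrow> real) \<Rightarrow> real" where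
  "Q2 a i c = - (\<Sum>\<^sub>\<infinity>k\<in>{1..}. \<Sum>\<^sub>\<infinity>j\<in>{k..}. a j i k * c j * c i)"

definition Q3 :: "(nat \<Rightarrow> nat \<Rightarrow> nat \<Rightarrow> real) \<Rightarrow> nat \<Rightarrow> (nat \<Rightarrow> real) \<Rightarrow> real" where
  "Q3 a i c = (\<Sum>k=1..i. \<Sum>\<^sub>\<infinity>j\<in>{k..}. a j (i - k) k * c j * c (i - k))"

definition Q4 :: "(nat \<Rightarrow> nat \<Rightarrow> nat \<Rightarrow> real) \<Rightarrow> nat \<Rightarrow> (nat \<Rightarrow> real) \<Rightarrow> real" where
  "Q4 a i c = - (\<Sum>k=1..i. \<Sum>\<^sub>\<infinity>j\<in>UNIV. a i j k * c j * c i)"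

text \<open>
  Convergence of the series in \<^const>\<open>Q1\<close>--\<^const>\<open>Q4\<close>. It has to be required explicitly, because
  \<^const>\<open>infsum\<close> silently returns \<open>0\<close> for a divergent series. For nonnegative \<open>c\<close> all terms are
  nonnegative, so summability over the set of index pairs is the same as convergence of the
  iterated series.
\<close>

definition Q_converge :: "(nat \<Rightarrow> nat \<Rightarrow> nat \<Rightarrow> real) \<Rightarrow> nat \<Rightarrow> (nat \<Rightarrow> real) \<Rightarrow> bool" where
  "Q_converge a i c \<longleftrightarrow>
     (\<lambda>(k, j). a (i + k) j k * c (i + k) * c j) summable_on ({1..} \<times> UNIV) \<and>
     (\<lambda>(k, j). a j i k * c j * c i) summable_on (SIGMA k:{1..}. {k..}) \<and>
     (\<forall>k\<in>{1..i}. (\<lambda>j. a j (i - k) k * c j * c (i - k)) summable_on {k..}) \<and>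
     (\<forall>k\<in>{1..i}. (\<lambda>j. a i j k * c j * c i) summable_on UNIV)"

text \<open>
  Mild solutions on $[0,T)$, with \<open>T = \<infinity>\<close> allowed. The values of \<open>c\<close> outside $[0,T)$ are
  irrelevant. Membership of $Q_{j,i}(c(\cdot))$ in $L^1(0,t)$ means that the series defining it
  converges almost everywhere and that the resulting function is integrable.
\<close>

definition mild_solution ::
  "(nat \<Rightarrow> nat \<Rightarrow> nat \<Rightarrow> real) \<Rightarrow> ereal \<Rightarrow> (nat \<Rightarrow> real) \<Rightarrow> (real \<Rightarrow> nat \<Rightarrow> real) \<Rightarrow> bool" where
  "mild_solution a T cin c \<longleftrightarrow>
     (\<forall>t. 0 \<le> t \<and> ereal t < T \<longrightarrow> c t \<in> X01_plus) \<and>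
     (\<forall>i. continuous_on {t. 0 \<le> t \<and> ereal t < T} (\<lambda>t. c t i)) \<and>
     (\<forall>i t. 0 < t \<and> ereal t < T \<longrightarrow>
        (AE s in lborel. s \<in> {0<..<t} \<longrightarrow> Q_converge a i (c s)) \<and>
        set_integrable lborel {0<..<t} (\<lambda>s. Q1 a i (c s)) \<and>
        set_integrable lborel {0<..<t} (\<lambda>s. Q2 a i (c s)) \<and>
        set_integrable lborel {0<..<t} (\<lambda>s. Q3 a i (c s)) \<and>
        set_integrable lborel {0<..<t} (\<lambda>s. Q4 a i (c s)) \<and>
        c t i = cin i + (LINT s:{0<..<t}|lborel.
          Q1 a i (c s) + Q2 a i (c s) + Q3 a i (c s) + Q4 a i (c s)))"

end

theory Submission
  imports Defs "HOL-Library.Diagonal_Subsequence"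
begin

text \<open>
  An event \<open>(p, r, k)\<close> moves \<open>k\<close> units from a cluster of size \<open>p\<close> to one of size \<open>r\<close>; it has rate
  \<open>a p r k * c p * c r\<close>. Explicit Euler iterates that only use the finitely many events with
  \<open>p, r < n\<close>, with a step size small enough to preserve positivity, conserve \<open>\<Sum>i. c i\<close> and \<open>\<Sum>i. i * c i\<close>.

  Compactness comes from the convex functions \<open>phi N\<close>, which are linear above \<open>N\<close> and tend to
  \<open>0\<close> pointwise as \<open>N\<close> grows. The growth assumption yields a Gronwall estimate for
  \<open>\<Sum>i. phi N i * c i\<close> that is uniform in \<open>n\<close>; initially this moment is small for large \<open>N\<close>,
  so first moments cannot escape to infinity. The rates \<open>a p 0 k\<close> are not bounded by the growth
  assumption, but an event \<open>(p, 0, k)\<close> is a fragmentation and lowers the moment by at least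
  \<open>1/2\<close> when \<open>p \<ge> N\<close>, so the same estimate bounds the time-integrated fragmentation of large clusters.

  Hence the total time-integrated flux of all events involving a cluster of size at least \<open>N\<close> is
  uniformly small. This gives equicontinuity of the iterates, hence a subsequence that
  converges pointwise in time, and it allows passing to the limit in the integrated equation.
\<close>

section \<open>Effect of one event on a moment, and the convex weights\<close>

text \<open>Weak form of the system: the moment of \<open>f\<close> changes at the rate obtained by
  summing flux times \<open>gap f\<close> over the events. Conservation laws are vanishing gaps,
  moment estimates are upper bounds on gaps. The truncated subtraction is harmless for
  \<open>k \<le> p\<close>.\<close>

fun gap :: "(nat \<Rightarrow> real) \<Rightarrow> nat \<times> nat \<times> nat \<Rightarrow> real" where
  "gap f (p, r, k) = f (p - k) + f (r + k) - f p - f r"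

declare gap.simps [simp del]

text \<open>The increments \<open>min m N / N\<close> are nondecreasing in \<open>m\<close>
  (convexity), at most 1, and tend to 0 as \<open>N\<close> grows: quadratic up to \<open>N\<close>,
  slope 1 beyond. For \<open>N = 0\<close> division by zero makes the function vanish.\<close>

definition phi :: "nat \<Rightarrow> nat \<Rightarrow> real" where
  "phi N i = (\<Sum>m=1..i. real (min m N)) / real N"

lemma phi_0 [simp]: "phi N 0 = 0"
  by (simp add: phi_def)

lemma phi_Suc: "phi N (Suc i) = phi N i + real (min (Suc i) N) / real N"
  by (simp add: phi_def add_divide_distrib)

lemma phi_nonneg [simp]: "0 \<le> phi N i"
  by (simp add: phi_def sum_nonneg)

lemma phi_add: "phi N (i + k) = phi N i + (\<Sum>m=1..k. real (min (i + m) N)) / real N"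
  by (induction k) (simp_all add: phi_Suc add_divide_distrib)

lemma phi_lipschitz:
  assumes "i \<le> j"
  shows "phi N i \<le> phi N j" "phi N j \<le> phi N i + real (j - i)"
proof -
  obtain k where k: "j = i + k" using assms le_Suc_ex by blast
  have "(\<Sum>m=1..k. real (min (i + m) N)) / real N \<le> real k" if "N > 0"
  proof -
    have "(\<Sum>m=1..k. real (min (i + m) N)) \<le> (\<Sum>m=1..k. real N)"
      by (intro sum_mono) simp
    with that show ?thesis by (simp add: field_simps)
  qed
  then have "(\<Sum>m=1..k. real (min (i + m) N)) / real N \<le> real k"
    by (cases "N = 0") auto
  then show "phi N j \<le> phi N i + real (j - i)" by (simp add: k phi_add)
  show "phi N i \<le> phi N j" by (simp add: k phi_add sum_nonneg)
qed

lemma phi_le: "phi N i \<le> real i"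
  using phi_lipschitz(2)[of 0 i N] by simp

text \<open>The concave function \<open>min m N\<close> of \<open>m\<close> lies above its chord
  from 0 to \<open>i\<close>, so its average over \<open>m \<le> i\<close> is at least half its last
  value.\<close>

lemma phi_lower: "real i * real (min i N) \<le> 2 * real N * phi N i"
proof (cases "N = 0")
  case False
  have "real i * real (min i N) \<le> 2 * (\<Sum>m=1..i. real (min m N))"
  proof (induction i)
    case (Suc i)
    show ?case
    proof (cases "Suc i \<le> N")
      case True
      then show ?thesis using Suc by (simp add: min_def algebra_simps)
    next
      case F: False
      then have "real i * real N \<le> 2 * (\<Sum>m=1..i. real (min m N)) + real N"
        using Suc by (cases "i = N") (auto simp: min_def split: if_splits)
      then show ?thesis using F by (simp add: min_def algebra_simps)
    qed
  qed simp
  then show ?thesis using False by (simp add: phi_def)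
qed simp

text \<open>Together with \<open>phi_le\<close> this makes \<open>phi N\<close> comparable to the
  size on the tail, so a small \<open>phi N\<close> moment leaves little mass in large
  clusters.\<close>

lemma phi_ge_half:
  assumes "N \<le> i" "0 < N"
  shows "real i \<le> 2 * phi N i"
proof -
  have "real i * real N \<le> (2 * phi N i) * real N"
    using phi_lower[of i N] assms by (simp add: min_def mult_ac split: if_splits)
  then show ?thesis using assms by simp
qed

text \<open>The \<open>k\<close> increments gained from \<open>r\<close> to \<open>r + k\<close> are
  paired with the \<open>k\<close> lost from \<open>p - k\<close> to \<open>p\<close>; signs can
  then be read off term by term.\<close>

lemma gap_phi_eq:
  assumes "k \<le> p"
  shows "gap (phi N) (p, r, k)
    = (\<Sum>m=1..k. real (min (r + m) N) - real (min (p - k + m) N)) / real N"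
proof -
  have "phi N p = phi N (p - k) + (\<Sum>m=1..k. real (min (p - k + m) N)) / real N"
    using phi_add[of N "p - k" k] assms by simp
  then show ?thesis by (simp add: gap.simps phi_add[of N r k] sum_subtractf diff_divide_distrib)
qed

text \<open>The form fits the hypotheses: \<open>r + k\<close> is a factor of the bound on
  \<open>a p r k\<close>, and the factors \<open>k\<close> and \<open>p\<close> are what
  \<open>q_sum\<close> supplies and consumes after summation over \<open>k\<close>. A positive gap
  forces \<open>p < r + k\<close>, and then three bounds on the gap are combined with lower bounds
  on \<open>phi N\<close>.\<close>

lemma gap_phi_bound:
  assumes "1 \<le> k" "k \<le> p" "0 < N"
  shows "real p * real (r + k) * gap (phi N) (p, r, k)
    \<le> 4 * real k * (real p * phi N r + real r * phi N p)"
proof (cases "gap (phi N) (p, r, k) \<le> 0")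
  case True
  then have "real p * real (r + k) * gap (phi N) (p, r, k) \<le> 0"
    by (intro mult_nonneg_nonpos) auto
  moreover have "0 \<le> 4 * real k * (real p * phi N r + real r * phi N p)" by simp
  ultimately show ?thesis by linarith
next
  case False
  let ?g = "gap (phi N) (p, r, k)"
  \<comment> \<open>If \<open>r + k \<le> p\<close>, both new sizes lie between the old ones, and
    convexity makes the gap nonpositive.\<close>
  have rk: "p < r + k"
  proof (rule ccontr)
    assume "\<not> p < r + k"
    then have "(\<Sum>m=1..k. real (min (r + m) N) - real (min (p - k + m) N)) \<le> 0"
      by (intro sum_nonpos) auto
    then have "?g \<le> 0" using assms by (simp add: gap_phi_eq divide_le_0_iff)
    with False show False by simp
  qed
  \<comment> \<open>Subadditivity: \<open>min (r + m) N \<le> min r N + min m N\<close>, and the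
    subtracted term is at least \<open>min m N\<close>.\<close>
  have "(\<Sum>m=1..k. real (min (r + m) N) - real (min (p - k + m) N)) \<le> (\<Sum>m=1..k. real (min r N))"
    by (intro sum_mono) (use assms rk in auto)
  then have g1: "real N * ?g \<le> real k * real (min r N)"
    using assms by (simp add: gap_phi_eq)
  \<comment> \<open>Regroup: \<open>phi N (r + k) - phi N p\<close> is at most
    \<open>r + k - p \<le> r\<close>, and \<open>phi N (p - k) - phi N r\<close> is at most
    0.\<close>
  have g2: "?g \<le> real r"
  proof -
    have "p - k \<le> r" "real (r + k - p) \<le> real r" using rk assms by auto
    then show ?thesis
      using phi_lipschitz(2)[of p "r + k" N] phi_lipschitz(1)[of "p - k" r N] rk
      by (simp add: gap.simps)
  qed
  have g0: "0 \<le> ?g" using False by linarith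
  have g3: "?g \<le> real k"
  proof -
    have "real (min r N) * real k \<le> real N * real k" by (intro mult_right_mono) auto
    with g1 have "real N * ?g \<le> real N * real k" by (simp only: mult.commute)
    with assms show ?thesis by simp
  qed
  have N: "0 < real N" using assms by simp
  show ?thesis
  \<comment> \<open>For \<open>p \<le> r\<close>, \<open>r + k \<le> 2 * r\<close> and the term
    \<open>p * phi N r\<close> suffices. Otherwise \<open>r * phi N p\<close> does: up to
    \<open>N\<close> by \<open>r + k \<le> 2 * p\<close> and the quadratic lower bound, beyond
    \<open>N\<close> by \<open>p \<le> 2 * phi N p\<close>.\<close>
  proof (cases "p \<le> r")
    case True
    have "real N * (real (r + k) * ?g) = real (r + k) * (real N * ?g)" by simp
    also have "\<dots> \<le> (2 * real r) * (real k * real (min r N))"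
      by (intro mult_mono g1) (use True assms g0 in auto)
    also have "\<dots> = 2 * real k * (real r * real (min r N))" by simp
    also have "\<dots> \<le> 2 * real k * (2 * real N * phi N r)"
      by (intro mult_left_mono phi_lower) auto
    also have "\<dots> = real N * (4 * real k * phi N r)" by simp
    finally have "real (r + k) * ?g \<le> 4 * real k * phi N r" using N by simp
    then have "real p * (real (r + k) * ?g) \<le> real p * (4 * real k * phi N r)"
      by (intro mult_left_mono) auto
    also have "\<dots> \<le> 4 * real k * (real p * phi N r + real r * phi N p)"
      by (simp add: algebra_simps)
    finally show ?thesis by (simp add: mult.assoc)
  next
    case pr: False
    have "real p * (real (r + k) * ?g) \<le> 4 * real k * real r * phi N p"
    proof (cases "p \<le> N")
      case True
      have "real N * (real p * (real (r + k) * ?g)) = real p * real (r + k) * (real N * ?g)" by simp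
      also have "\<dots> \<le> real p * (2 * real p) * (real k * real r)"
        by (intro mult_mono order.trans[OF g1]) (use pr assms g0 in auto)
      also have "\<dots> = 2 * real k * real r * (real p * real (min p N))" using True by simp
      also have "\<dots> \<le> 2 * real k * real r * (2 * real N * phi N p)"
        by (intro mult_left_mono phi_lower) auto
      also have "\<dots> = real N * (4 * real k * real r * phi N p)" by simp
      finally show ?thesis using N by (metis mult_le_cancel_left_pos)
    next
      case False
      have "real (r + k) * ?g = real r * ?g + real k * ?g" by (simp add: algebra_simps)
      also have "\<dots> \<le> real r * real k + real k * real r"
        by (intro add_mono mult_left_mono g2 g3) auto
      finally have "real p * (real (r + k) * ?g) \<le> real p * (2 * real k * real r)"
        by (intro mult_left_mono) auto
      also have "\<dots> \<le> (2 * phi N p) * (2 * real k * real r)"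
        by (intro mult_right_mono phi_ge_half) (use False assms in auto)
      finally show ?thesis by (simp add: mult_ac)
    qed
    also have "\<dots> \<le> 4 * real k * (real p * phi N r + real r * phi N p)"
      by (simp add: algebra_simps)
    finally show ?thesis by (simp add: mult.assoc)
  qed
qed

text \<open>Convexity and \<open>phi N 0 = 0\<close> make \<open>phi N\<close> superadditive, so
  splitting a cluster cannot raise its weight.\<close>

lemma gap_phi_fragmentation:
  assumes "1 \<le> k" "k \<le> p"
  shows "gap (phi N) (p, 0, k) \<le> 0"
proof -
  have "(\<Sum>m=1..k. real (min (0 + m) N) - real (min (p - k + m) N)) \<le> 0"
    by (intro sum_nonpos) auto
  then show ?thesis using assms by (simp add: gap_phi_eq divide_le_0_iff)
qed

text \<open>The gap is symmetric under exchanging \<open>k\<close> and \<open>p - k\<close>, so the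
  smaller piece may be taken as the one that leaves. For \<open>k = p\<close> nothing changes and
  the gap is 0.\<close>

lemma gap_phi_fragmentation_strict:
  assumes "1 \<le> k" "k < p" "N \<le> p" "2 \<le> N"
  shows "gap (phi N) (p, 0, k) \<le> - (1/2)"
proof -
  have *: "gap (phi N) (p, 0, k) \<le> - (1/2)" if k: "1 \<le> k" "k \<le> p - k" for k
  proof -
    have kp: "k \<le> p" using k by linarith
    \<comment> \<open>All terms are nonpositive, and the one for \<open>m = 1\<close> is already at
      most \<open>- N / 2\<close>.\<close>
    have "(\<Sum>m=1..k. real (min (0 + m) N) - real (min (p - k + m) N))
        \<le> (\<Sum>m=1..k. if m = 1 then real (min 1 N) - real (min (p - k + 1) N) else 0)"
      by (intro sum_mono) auto
    also have "\<dots> = 1 - real (min (p - k + 1) N)" using k assms by simp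
    also have "\<dots> \<le> - real N / 2"
    proof -
      have "real p \<le> 2 * real (p - k)" using k kp by linarith
      moreover have "real N \<le> real p" "2 \<le> real N" using assms by auto
      ultimately show ?thesis by (auto simp: min_def)
    qed
    finally show ?thesis using assms kp by (simp add: gap_phi_eq field_simps)
  qed
  show ?thesis
  proof (cases "k \<le> p - k")
    case False
    have "gap (phi N) (p, 0, k) = gap (phi N) (p, 0, p - k)" using assms by (simp add: gap.simps)
    with *[of "p - k"] False assms show ?thesis by simp
  qed (use * assms in auto)
qed

text \<open>Dominated convergence for series: \<open>phi N i\<close> is at most
  \<open>i * i / N\<close>, and \<open>real i * c i\<close> is a summable majorant. A finite first
  moment is thus enough.\<close>

lemma phi_vanishes:
  assumes "summable (\<lambda>i. real i * c i)" "\<And>i. 0 \<le> c i"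
  shows "(\<lambda>N. \<Sum>i. phi N i * c i) \<longlonglongrightarrow> 0"
proof -
  have "(\<lambda>N. phi N i * c i) \<longlonglongrightarrow> 0" for i
  proof -
    have lim: "(\<lambda>N. real (i * i) * c i * (1 / real N)) \<longlonglongrightarrow> 0"
      by (intro tendsto_mult_right_zero lim_1_over_n)
    have "\<forall>\<^sub>F N in sequentially. norm (phi N i * c i) \<le> real (i * i) * c i * (1 / real N)"
    proof (intro eventually_sequentiallyI[of 1])
      fix N :: nat
      have "(\<Sum>m=1..i. real (min m N)) \<le> (\<Sum>m=1..i. real i)" by (intro sum_mono) auto
      then have "phi N i \<le> real (i * i) * (1 / real N)"
        unfolding phi_def by (simp add: divide_right_mono)
      then show "norm (phi N i * c i) \<le> real (i * i) * c i * (1 / real N)"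
        using assms(2)[of i] mult_right_mono[of "phi N i" "real (i * i) * (1 / real N)" "c i"]
        by (simp add: abs_mult mult_ac)
    qed
    then show ?thesis using lim by (rule Lim_null_comparison)
  qed
  moreover have "\<forall>\<^sub>F (k, N) in sequentially \<times>\<^sub>F sequentially. norm (phi N k * c k) \<le> real k * c k"
    using assms(2) phi_le by (intro always_eventually) (auto simp: abs_mult mult_right_mono)
  ultimately have "(\<lambda>N. \<Sum>i. phi N i * c i) \<longlonglongrightarrow> (\<Sum>i. 0)"
    using tannerys_theorem[where a = "\<lambda>i N. phi N i * c i" and b = "\<lambda>_. 0" and F = sequentially] assms(1)
    by auto
  then show ?thesis by simp
qed

section \<open>Events and their finite windows\<close>

definition window :: "nat \<Rightarrow> (nat \<times> nat \<times> nat) set" where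
  "window n = (SIGMA p:{..<n}. SIGMA r:{..<n}. {1..p})"

definition events :: "(nat \<times> nat \<times> nat) set" where
  "events = {(p, r, k). 1 \<le> k \<and> k \<le> p}"

text \<open>As a test function in \<open>gap\<close> it gives the net change in the number of
  clusters of size \<open>i\<close>, which is the coefficient of the event in the i-th
  equation.\<close>

definition unit_at :: "nat \<Rightarrow> nat \<Rightarrow> real" where
  "unit_at i x = of_bool (x = i)"

lemma mem_window: "(p, r, k) \<in> window n \<longleftrightarrow> p < n \<and> r < n \<and> 1 \<le> k \<and> k \<le> p"
  by (auto simp: window_def)

lemma finite_window [simp]: "finite (window n)"
  by (simp add: window_def)

lemma window_mono: "m \<le> n \<Longrightarrow> window m \<subseteq> window n"
  by (auto simp: mem_window)

lemma window_subset_events: "window n \<subseteq> events"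
  by (auto simp: mem_window events_def)

lemma sum_window: "(\<Sum>e\<in>window n. f e) = (\<Sum>p<n. \<Sum>r<n. \<Sum>k=1..p. f (p, r, k))"
  unfolding window_def by (simp add: sum.Sigma split_def)

lemma abs_gap_unit_le: "\<bar>gap (unit_at i) e\<bar> \<le> 2"
  by (cases e) (auto simp: gap.simps unit_at_def)

text \<open>Every \<open>f\<close> is the combination of the \<open>unit_at i\<close> with
  coefficients \<open>f i\<close>, and \<open>gap\<close> is linear; at most four terms of the
  series are nonzero.\<close>

lemma sums_gap_unit: "(\<lambda>i. f i * gap (unit_at i) e) sums gap f e"
proof -
  obtain p r k where e: "e = (p, r, k)" by (cases e)
  have *: "(\<lambda>i. f i * of_bool (x = i)) sums f x" for x
    using sums_single[of x f] by (rule sums_cong[THEN iffD1, rotated]) auto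
  have "(\<lambda>i. f i * of_bool (p - k = i) + f i * of_bool (r + k = i)
      - f i * of_bool (p = i) - f i * of_bool (r = i)) sums (f (p - k) + f (r + k) - f p - f r)"
    by (intro sums_add sums_diff *)
  then show ?thesis by (simp add: e gap.simps unit_at_def algebra_simps)
qed

lemma gap_const [simp]: "gap (\<lambda>_. x) e = 0"
  by (cases e) (simp add: gap.simps)

lemma gap_id: "e \<in> events \<Longrightarrow> gap real e = 0"
  by (auto simp: events_def gap.simps of_nat_diff)

subsection \<open>Euler iterates and tail estimates\<close>

locale dged =
  fixes a :: "nat \<Rightarrow> nat \<Rightarrow> nat \<Rightarrow> real"
    and q :: "nat \<Rightarrow> nat \<Rightarrow> real"
    and C Q :: real
    and cin :: "nat \<Rightarrow> real"
  assumes rates: "rate_coefficients a"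
    and cin: "cin \<in> X01_plus"
    and C: "C \<ge> 1" and Q: "Q \<ge> 1"
    and q_nonneg: "\<And>i k. 1 \<le> k \<Longrightarrow> k \<le> i \<Longrightarrow> 0 \<le> q i k"
    and q_sum: "\<And>i. 1 \<le> i \<Longrightarrow>
           (\<Sum>k=1..i. real k * real (i - k + 1) * q i k) \<le> Q * real i"
    and a_le: "\<And>i j k. 1 \<le> k \<Longrightarrow> k \<le> i \<Longrightarrow> 1 \<le> j \<Longrightarrow>
           a i j k \<le> C * real (i - k + 1) * real (j + k) * q i k"
begin

lemma a_nonneg: "1 \<le> k \<Longrightarrow> k \<le> p \<Longrightarrow> 0 \<le> a p r k"
  using rates by (simp add: rate_coefficients_def)

lemma a_swap_zero: "1 \<le> p \<Longrightarrow> a p 0 p = 0"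
  using rates by (simp add: rate_coefficients_def)

definition flux :: "(nat \<Rightarrow> real) \<Rightarrow> nat \<times> nat \<times> nat \<Rightarrow> real" where
  "flux c = (\<lambda>(p, r, k). a p r k * c p * c r)"

definition mass0 :: real where "mass0 = (\<Sum>i. cin i)"
definition mass1 :: real where "mass1 = (\<Sum>i. real i * cin i)"
text \<open>The Gronwall rate: \<open>4 * C * Q\<close> from the gap bound, doubled because both
  orders of a pair contribute, times the conserved first moment.\<close>

definition growth :: real where "growth = 8 * C * Q * mass1"

lemma cin_nonneg: "0 \<le> cin i"
  using cin by (simp add: X01_plus_def)

lemma summable_cin: "summable cin" "summable (\<lambda>i. real i * cin i)"
proof -
  have *: "summable (\<lambda>i. (1 + real i) * cin i)"
  proof -
    have "(\<lambda>i. (1 + real i) * \<bar>cin i\<bar>) = (\<lambda>i. (1 + real i) * cin i)"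
      using cin_nonneg by simp
    moreover have "summable (\<lambda>i. (1 + real i) * \<bar>cin i\<bar>)"
      using cin unfolding X01_plus_def X01_def by blast
    ultimately show ?thesis by simp
  qed
  show "summable cin"
    by (rule summable_comparison_test'[OF *, of 0]) (simp add: cin_nonneg algebra_simps)
  show "summable (\<lambda>i. real i * cin i)"
    by (rule summable_comparison_test'[OF *, of 0]) (simp add: cin_nonneg algebra_simps)
qed

lemma mass_nonneg: "0 \<le> mass0" "0 \<le> mass1" "0 \<le> growth"
proof -
  show "0 \<le> mass0" "0 \<le> mass1"
    by (auto simp: mass0_def mass1_def cin_nonneg summable_cin intro!: suminf_nonneg)
  then show "0 \<le> growth" using C Q by (simp add: growth_def)
qed

text \<open>The invariant of the Euler steps. Both moments are fixed exactly, so every bound derived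
  from it is uniform in \<open>n\<close> and in the number of steps.\<close>

definition admissible :: "(nat \<Rightarrow> real) \<Rightarrow> bool" where
  "admissible c \<longleftrightarrow> (\<forall>i. 0 \<le> c i) \<and> c sums mass0 \<and> (\<lambda>i. real i * c i) sums mass1"

lemma admissible_cin: "admissible cin"
  by (simp add: admissible_def cin_nonneg mass0_def mass1_def summable_cin summable_sums)

lemma admissible_le: "admissible c \<Longrightarrow> c i \<le> mass0"
  using sum_le_suminf[of c "{i}"] by (auto simp: admissible_def sums_iff)

lemma summable_phi: "admissible c \<Longrightarrow> summable (\<lambda>i. phi N i * c i)"
  unfolding admissible_def sums_iff
  by (rule summable_comparison_test'[of "\<lambda>i. real i * c i" 0]) (auto intro!: mult_right_mono phi_le)

lemma flux_nonneg: "admissible c \<Longrightarrow> e \<in> events \<Longrightarrow> 0 \<le> flux c e"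
  by (auto simp: flux_def events_def admissible_def a_nonneg)

text \<open>One or both densities are replaced by \<open>mass0\<close>. The versions linear in
  \<open>c p\<close> or \<open>c r\<close> serve positivity, the last one equicontinuity.\<close>

lemma flux_le: 
  assumes "admissible c" "(p, r, k) \<in> events"
  shows "flux c (p, r, k) \<le> a p r k * mass0 * c p" "flux c (p, r, k) \<le> a p r k * mass0 * c r"
    "flux c (p, r, k) \<le> a p r k * mass0 * mass0"
proof -
  have *: "0 \<le> a p r k" "0 \<le> c p" "0 \<le> c r" "c p \<le> mass0" "c r \<le> mass0"
    using assms admissible_le[OF assms(1)] by (auto simp: events_def a_nonneg admissible_def)
  show "flux c (p, r, k) \<le> a p r k * mass0 * c p" 
    using * mult_left_mono[of "c r" mass0 "a p r k * c p"] by (simp add: flux_def mult_ac)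
  show "flux c (p, r, k) \<le> a p r k * mass0 * c r"
    using * mult_left_mono[of "c p" mass0 "a p r k * c r"] by (simp add: flux_def mult_ac)
  show "flux c (p, r, k) \<le> a p r k * mass0 * mass0"
    unfolding flux_def using * mass_nonneg by (auto intro!: mult_mono)
qed

definition rate_total :: "nat \<Rightarrow> real" where
  "rate_total n = (\<Sum>(p, r, k)\<in>window n. a p r k)"

lemma rate_total_nonneg: "0 \<le> rate_total n"
  unfolding rate_total_def by (rule sum_nonneg) (auto simp: mem_window a_nonneg)

text \<open>Only the events are truncated, not the data, and a target size \<open>r + k\<close> may
  reach \<open>n\<close> or more; clusters of size at least \<open>n\<close> are inert. This keeps
  both moments exact.\<close>

definition euler :: "nat \<Rightarrow> real \<Rightarrow> (nat \<Rightarrow> real) \<Rightarrow> nat \<Rightarrow> real" where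
  "euler n h c i = c i + h * (\<Sum>e\<in>window n. flux c e * gap (unit_at i) e)"

text \<open>The event sum is finite and can be exchanged with the moment series: the discrete weak
  form, used with \<open>f\<close> equal to 1, \<open>real\<close> and \<open>phi N\<close>.\<close>

lemma euler_sums:
  assumes "summable (\<lambda>i. f i * c i)"
  shows "(\<lambda>i. f i * euler n h c i) sums ((\<Sum>i. f i * c i) + h * (\<Sum>e\<in>window n. flux c e * gap f e))"
proof -
  have "(\<lambda>i. f i * c i + h * (\<Sum>e\<in>window n. flux c e * (f i * gap (unit_at i) e)))
      sums ((\<Sum>i. f i * c i) + h * (\<Sum>e\<in>window n. flux c e * gap f e))"
    by (intro sums_add sums_mult sums_sum sums_gap_unit summable_sums assms)
  then show ?thesis by (simp add: euler_def algebra_simps sum_distrib_left)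
qed

text \<open>All losses of \<open>c i\<close> are proportional to \<open>c i\<close>, with total rate
  at most \<open>2 * mass0 * rate_total n\<close>; such a step removes no more than is
  present.\<close>

lemma euler_nonneg:
  assumes "admissible c" "0 \<le> h" "h * (2 * mass0 * rate_total n) \<le> 1"
  shows "0 \<le> euler n h c i"
proof -
  have c: "0 \<le> c j" for j using assms(1) by (simp add: admissible_def)
  have "- (\<Sum>e\<in>window n. flux c e * gap (unit_at i) e) = (\<Sum>e\<in>window n. - (flux c e * gap (unit_at i) e))"
    by (simp add: sum_negf)
  also have "\<dots> \<le> (\<Sum>(p, r, k)\<in>window n. 2 * mass0 * c i * a p r k)"
  proof (rule sum_mono)
    fix e assume e: "e \<in> window n"
    obtain p r k where prk: "e = (p, r, k)" by (cases e)
    have ev: "(p, r, k) \<in> events" using e window_subset_events prk by blast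
    \<comment> \<open>Size \<open>i\<close> can lose a cluster only as donor or as receiver.\<close>
    have "- gap (unit_at i) e \<le> of_bool (p = i) + of_bool (r = i)"
      by (simp add: prk gap.simps unit_at_def)
    then have "flux c e * (- gap (unit_at i) e) \<le> flux c e * (of_bool (p = i) + of_bool (r = i))"
      using flux_nonneg[OF assms(1)] ev prk by (intro mult_left_mono) auto
    also have "\<dots> \<le> a p r k * mass0 * c i + a p r k * mass0 * c i"
    proof -
      have "flux c e * of_bool (p = i) \<le> a p r k * mass0 * c i"
        "flux c e * of_bool (r = i) \<le> a p r k * mass0 * c i"
        using flux_le[OF assms(1) ev] a_nonneg ev mass_nonneg c prk by (auto simp: events_def)
      then have "flux c e * of_bool (p = i) + flux c e * of_bool (r = i)
        \<le> a p r k * mass0 * c i + a p r k * mass0 * c i" by (rule add_mono)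
      then show ?thesis unfolding distrib_left .
    qed
    finally show "- (flux c e * gap (unit_at i) e) \<le> (case e of (p, r, k) \<Rightarrow> 2 * mass0 * c i * a p r k)"
      by (simp add: prk)
  qed
  also have "\<dots> = 2 * mass0 * rate_total n * c i"
    by (simp add: rate_total_def sum_distrib_left sum_distrib_right split_def mult_ac)
  finally have "h * - (\<Sum>e\<in>window n. flux c e * gap (unit_at i) e) \<le> h * (2 * mass0 * rate_total n * c i)"
    using assms(2) by (rule mult_left_mono)
  also have "\<dots> \<le> 1 * c i"
    using mult_right_mono[OF assms(3) c[of i]] by (simp add: mult_ac)
  finally show ?thesis by (simp add: euler_def)
qed

lemma euler_admissible:
  assumes "admissible c" "0 \<le> h" "h * (2 * mass0 * rate_total n) \<le> 1"
  shows "admissible (euler n h c)"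
proof -
  have s: "summable (\<lambda>i. 1 * c i)" "summable (\<lambda>i. real i * c i)"
    "(\<Sum>i. c i) = mass0" "(\<Sum>i. real i * c i) = mass1"
    using assms by (auto simp: admissible_def sums_iff)
  have "(\<Sum>e\<in>window n. flux c e * gap real e) = 0"
    using gap_id window_subset_events by (intro sum.neutral) (metis mult_zero_right subsetD)
  then show ?thesis
    using euler_sums[OF s(1), of n h] euler_sums[OF s(2), of n h] euler_nonneg[OF assms] s(3,4)
    by (simp add: admissible_def)
qed

section \<open>Moment growth and flux of large clusters\<close>

text \<open>The part of the tail flux outside the growth hypothesis, which concerns
  \<open>1 \<le> j\<close>; \<open>moment_rate\<close> controls it by dissipation.\<close>

definition frag :: "nat \<Rightarrow> nat \<Rightarrow> (nat \<Rightarrow> real) \<Rightarrow> real" where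
  "frag n N c = (\<Sum>e\<in>window n. if fst (snd e) = 0 \<and> N \<le> fst e then flux c e else 0)"

lemma frag_nonneg: "admissible c \<Longrightarrow> 0 \<le> frag n N c"
  unfolding frag_def using flux_nonneg subsetD[OF window_subset_events] by (intro sum_nonneg) auto

text \<open>After multiplication by \<open>p\<close>, \<open>gap_phi_bound\<close> and the growth
  bound leave exactly the sum in \<open>q_sum\<close>; its value \<open>Q * p\<close> lets
  \<open>p\<close> be cancelled.\<close>

lemma sum_k_bound:
  assumes "1 \<le> p" "1 \<le> r" "0 < N"
  shows "(\<Sum>k=1..p. a p r k * gap (phi N) (p, r, k)) \<le> 4 * C * Q * (real p * phi N r + real r * phi N p)"
proof -
  let ?B = "real p * phi N r + real r * phi N p"
  have B: "0 \<le> ?B" by simp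
  have "real p * (\<Sum>k=1..p. a p r k * gap (phi N) (p, r, k))
     = (\<Sum>k=1..p. real p * (a p r k * gap (phi N) (p, r, k)))" by (simp add: sum_distrib_left)
  also have "\<dots> \<le> (\<Sum>k=1..p. (4 * C * ?B) * (real k * real (p - k + 1) * q p k))"
  proof (rule sum_mono)
    fix k assume "k \<in> {1..p}"
    then have k: "1 \<le> k" "k \<le> p" by auto
    have R: "0 \<le> (4 * C * ?B) * (real k * real (p - k + 1) * q p k)"
      using B C q_nonneg[OF k] by (intro mult_nonneg_nonneg) auto
    show "real p * (a p r k * gap (phi N) (p, r, k)) \<le> (4 * C * ?B) * (real k * real (p - k + 1) * q p k)"
    \<comment> \<open>The upper bound on \<open>a p r k\<close> may be multiplied only by a
      nonnegative gap; a nonpositive one is discarded.\<close>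
    proof (cases "gap (phi N) (p, r, k) \<le> 0")
      case True
      then have "real p * (a p r k * gap (phi N) (p, r, k)) \<le> 0"
        using a_nonneg[OF k] by (intro mult_nonneg_nonpos) auto
      with R show ?thesis by linarith
    next
      case False
      then have "real p * (a p r k * gap (phi N) (p, r, k)) \<le>
          real p * ((C * real (p - k + 1) * real (r + k) * q p k) * gap (phi N) (p, r, k))"
        using a_le[OF k assms(2)] by (intro mult_left_mono mult_right_mono) auto
      also have "\<dots> = (C * real (p - k + 1) * q p k) * (real p * real (r + k) * gap (phi N) (p, r, k))"
        by (simp add: mult_ac)
      also have "\<dots> \<le> (C * real (p - k + 1) * q p k) * (4 * real k * ?B)"
        using C q_nonneg[OF k] gap_phi_bound[OF k assms(3)] by (intro mult_left_mono mult_nonneg_nonneg) auto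
      finally show ?thesis by (simp add: mult_ac)
    qed
  qed
  also have "\<dots> = (4 * C * ?B) * (\<Sum>k=1..p. real k * real (p - k + 1) * q p k)"
    by (simp add: sum_distrib_left)
  also have "\<dots> \<le> (4 * C * ?B) * (Q * real p)"
    using B C by (intro mult_left_mono q_sum assms) auto
  also have "\<dots> = real p * (4 * C * Q * ?B)" by simp
  finally show ?thesis using assms by (simp add: mult_le_cancel_left)
qed

lemma sum_a_bound:
  assumes "1 \<le> p" "1 \<le> r"
  shows "(\<Sum>k=1..p. a p r k) \<le> 2 * C * Q * (real p * real r)"
proof -
  have "(\<Sum>k=1..p. a p r k) \<le> (\<Sum>k=1..p. (2 * C * real r) * (real k * real (p - k + 1) * q p k))"
  proof (rule sum_mono)
    fix k assume "k \<in> {1..p}"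
    then have k: "1 \<le> k" "k \<le> p" by auto
    \<comment> \<open>From \<open>(r - 1) * (k - 1) \<ge> 0\<close> follows
      \<open>r + k \<le> r * k + 1\<close>, and \<open>1 \<le> r * k\<close>.\<close>
    have rk: "real (r + k) \<le> 2 * (real r * real k)"
    proof -
      have "(real r - 1) * (real k - 1) \<ge> 0" "real r * real k \<ge> 1"
        using k assms by (auto intro!: mult_nonneg_nonneg simp flip: of_nat_mult)
      then show ?thesis by (simp add: algebra_simps)
    qed
    have "a p r k \<le> (C * real (p - k + 1) * q p k) * real (r + k)"
      using a_le[OF k assms(2)] by (simp add: mult_ac)
    also have "\<dots> \<le> (C * real (p - k + 1) * q p k) * (2 * (real r * real k))"
      using C q_nonneg[OF k] by (intro mult_left_mono rk) auto
    finally show "a p r k \<le> (2 * C * real r) * (real k * real (p - k + 1) * q p k)"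
      by (simp add: mult_ac)
  qed
  also have "\<dots> \<le> (2 * C * real r) * (Q * real p)"
    unfolding sum_distrib_left[symmetric] using C by (intro mult_left_mono q_sum assms) auto
  finally show ?thesis by (simp add: mult_ac)
qed

text \<open>The double sum factors into twice the product of the truncated first moment and the
  truncated \<open>phi N\<close> moment.\<close>

lemma pair_sum_le:
  assumes "admissible c"
  shows "(\<Sum>p<n. \<Sum>r<n. c p * c r * (4 * C * Q * (real p * phi N r + real r * phi N p)))
    \<le> growth * (\<Sum>i. phi N i * c i)"
proof -
  let ?S = "\<Sum>p<n. real p * c p" and ?F = "\<Sum>p<n. phi N p * c p"
  have c: "0 \<le> c j" for j using assms(1) by (simp add: admissible_def)
  have "(\<Sum>p<n. \<Sum>r<n. c p * c r * (4 * C * Q * (real p * phi N r + real r * phi N p)))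
     = (\<Sum>p<n. \<Sum>r<n. 4 * C * Q * ((real p * c p) * (phi N r * c r) + (phi N p * c p) * (real r * c r)))"
    by (simp add: algebra_simps)
  also have "\<dots> = 4 * C * Q * (?S * ?F + ?F * ?S)"
    by (simp only: sum_product sum.distrib distrib_left flip: sum_distrib_left)
  also have "\<dots> = 8 * C * Q * (?S * ?F)" by simp
  also have "\<dots> \<le> 8 * C * Q * (mass1 * (\<Sum>i. phi N i * c i))"
  proof (intro mult_left_mono mult_mono)
    show "?S \<le> mass1" using sum_le_suminf[of "\<lambda>i. real i * c i" "{..<n}"] assms c
      by (auto simp: admissible_def sums_iff)
    show "?F \<le> (\<Sum>i. phi N i * c i)"
      using c by (intro sum_le_suminf summable_phi assms) auto
  qed (use c C Q mass_nonneg in \<open>auto intro!: sum_nonneg\<close>)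
  finally show ?thesis by (simp add: growth_def)
qed

text \<open>Pairs with \<open>1 \<le> r\<close> are covered by \<open>sum_k_bound\<close>. For
  \<open>r = 0\<close> and \<open>N \<le> p\<close> the gap is at most \<open>-1/2\<close>, which
  pays for half of \<open>frag\<close> on the left.\<close>

lemma moment_rate:
  assumes "admissible c" "2 \<le> N"
  shows "(\<Sum>e\<in>window n. flux c e * gap (phi N) e) + frag n N c / 2 \<le> growth * (\<Sum>i. phi N i * c i)"
proof -
  have c: "0 \<le> c j" for j using assms(1) by (simp add: admissible_def)
  have "(\<Sum>e\<in>window n. flux c e * gap (phi N) e) + frag n N c / 2
    = (\<Sum>p<n. \<Sum>r<n. \<Sum>k=1..p. flux c (p, r, k) * gap (phi N) (p, r, k)
        + (if r = 0 \<and> N \<le> p then flux c (p, r, k) else 0) / 2)"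
    by (simp add: frag_def sum_window sum.distrib sum_divide_distrib)
  also have "\<dots> \<le> (\<Sum>p<n. \<Sum>r<n. c p * c r * (4 * C * Q * (real p * phi N r + real r * phi N p)))"
  proof (intro sum_mono)
    fix p r
    show "(\<Sum>k=1..p. flux c (p, r, k) * gap (phi N) (p, r, k)
        + (if r = 0 \<and> N \<le> p then flux c (p, r, k) else 0) / 2)
      \<le> c p * c r * (4 * C * Q * (real p * phi N r + real r * phi N p))"
    proof (cases "r = 0")
      case True
      have "flux c (p, 0, k) * gap (phi N) (p, 0, k) + (if N \<le> p then flux c (p, 0, k) else 0) / 2 \<le> 0"
        if "k \<in> {1..p}" for k
      proof -
        have k: "1 \<le> k" "k \<le> p" using that by auto
        have f: "0 \<le> flux c (p, 0, k)" using k flux_nonneg[OF assms(1)] by (simp add: events_def)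
        show ?thesis
        proof (cases "N \<le> p")
          case True
          show ?thesis
          \<comment> \<open>Here the gap is 0 and gives no dissipation, but the rate
            \<open>a p 0 p\<close> vanishes.\<close>
          proof (cases "k = p")
            case True
            then show ?thesis using k a_swap_zero by (simp add: flux_def)
          next
            case False
            then have "gap (phi N) (p, 0, k) \<le> - (1/2)"
              using True k assms by (intro gap_phi_fragmentation_strict) auto
            from mult_left_mono[OF this f] show ?thesis using True by simp
          qed
        next
          case False
          then show ?thesis
            using mult_left_mono[OF gap_phi_fragmentation[OF k] f] by simp
        qed
      qed
      then have "(\<Sum>k=1..p. flux c (p, 0, k) * gap (phi N) (p, 0, k)
        + (if N \<le> p then flux c (p, 0, k) else 0) / 2) \<le> 0"
        by (rule sum_nonpos)
      moreover have "0 \<le> c p * c r * (4 * C * Q * (real p * phi N r + real r * phi N p))"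
        using c C Q by simp
      ultimately show ?thesis unfolding True by simp
    next
      case False
      show ?thesis
      proof (cases "p = 0")
        case p: False
        have "(\<Sum>k=1..p. flux c (p, r, k) * gap (phi N) (p, r, k))
          = c p * c r * (\<Sum>k=1..p. a p r k * gap (phi N) (p, r, k))"
          by (simp add: sum_distrib_left flux_def mult_ac)
        also have "\<dots> \<le> c p * c r * (4 * C * Q * (real p * phi N r + real r * phi N p))"
          using c p False assms by (intro mult_left_mono sum_k_bound) auto
        finally show ?thesis using False by simp
      qed simp
    qed
  qed
  also have "\<dots> \<le> growth * (\<Sum>i. phi N i * c i)" by (rule pair_sum_le[OF assms(1)])
  finally show ?thesis .
qed

text \<open>An event outside \<open>window N\<close> has \<open>N \<le> p\<close> or
  \<open>N \<le> r\<close>. If \<open>r = 0\<close> it is counted by \<open>frag\<close>; otherwise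
  \<open>p * r\<close> is bounded through \<open>phi_ge_half\<close> by the same symmetric
  expression as in \<open>pair_sum_le\<close>.\<close>

lemma tail_flux_le:
  assumes "admissible c" "1 \<le> N"
  shows "(\<Sum>e\<in>window n - window N. flux c e) \<le> frag n N c + growth * (\<Sum>i. phi N i * c i)"
proof -
  have c: "0 \<le> c j" for j using assms(1) by (simp add: admissible_def)
  have "(\<Sum>e\<in>window n - window N. flux c e) = (\<Sum>e\<in>window n. if e \<in> window N then 0 else flux c e)"
    by (rule sum.mono_neutral_cong_left) auto
  also have "\<dots> = (\<Sum>p<n. \<Sum>r<n. \<Sum>k=1..p. if (p, r, k) \<in> window N then 0 else flux c (p, r, k))"
    by (rule sum_window)
  also have "\<dots> \<le> (\<Sum>p<n. \<Sum>r<n. (\<Sum>k=1..p. if r = 0 \<and> N \<le> p then flux c (p, r, k) else 0)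
      + c p * c r * (4 * C * Q * (real p * phi N r + real r * phi N p)))"
  proof (intro sum_mono)
    fix p r
    let ?R = "c p * c r * (4 * C * Q * (real p * phi N r + real r * phi N p))"
    have R: "0 \<le> ?R" using c C Q by simp
    show "(\<Sum>k=1..p. if (p, r, k) \<in> window N then 0 else flux c (p, r, k))
      \<le> (\<Sum>k=1..p. if r = 0 \<and> N \<le> p then flux c (p, r, k) else 0) + ?R"
    \<comment> \<open>Such a pair has events outside \<open>window N\<close> only for
      \<open>r = 0\<close> and \<open>N \<le> p\<close>, since \<open>1 \<le> N\<close> puts
      \<open>r = 0\<close> below \<open>N\<close>.\<close>
    proof (cases "p < N \<and> r < N \<or> r = 0 \<or> p = 0")
      case True
      then have "(\<Sum>k=1..p. if (p, r, k) \<in> window N then 0 else flux c (p, r, k))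
        = (\<Sum>k=1..p. if r = 0 \<and> N \<le> p then flux c (p, r, k) else 0)"
        using assms by (intro sum.cong) (auto simp: mem_window)
      with R show ?thesis by linarith
    next
      case False
      then have pr: "1 \<le> p" "1 \<le> r" "N \<le> p \<or> N \<le> r" by auto
      have "(\<Sum>k=1..p. if (p, r, k) \<in> window N then 0 else flux c (p, r, k)) = (\<Sum>k=1..p. flux c (p, r, k))"
        using False by (intro sum.cong) (auto simp: mem_window)
      also have "\<dots> = c p * c r * (\<Sum>k=1..p. a p r k)"
        by (simp add: sum_distrib_left flux_def mult_ac)
      also have "\<dots> \<le> c p * c r * (2 * C * Q * (real p * real r))"
        using c pr by (intro mult_left_mono sum_a_bound) auto
      also have "\<dots> \<le> c p * c r * (2 * C * Q * (2 * (real p * phi N r + real r * phi N p)))"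
      proof -
        have "real p * real r \<le> 2 * (real p * phi N r + real r * phi N p)"
        proof (cases "N \<le> p")
          case True
          have "real p * real r \<le> (2 * phi N p) * real r"
            using True assms by (intro mult_right_mono phi_ge_half) auto
          then have "real p * real r \<le> 2 * (real r * phi N p)" by (simp add: mult_ac)
          also have "\<dots> \<le> 2 * (real p * phi N r + real r * phi N p)" by simp
          finally show ?thesis .
        next
          case False
          have "real p * real r \<le> real p * (2 * phi N r)"
            using False pr assms by (intro mult_left_mono phi_ge_half) auto
          then have "real p * real r \<le> 2 * (real p * phi N r)" by (simp add: mult_ac)
          also have "\<dots> \<le> 2 * (real p * phi N r + real r * phi N p)" by simp
          finally show ?thesis .
        qed
        then show ?thesis using c C Q by (intro mult_left_mono) auto
      qed
      also have "\<dots> = ?R" by simp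
      finally show ?thesis using False by simp
    qed
  qed
  also have "\<dots> = frag n N c + (\<Sum>p<n. \<Sum>r<n. c p * c r * (4 * C * Q * (real p * phi N r + real r * phi N p)))"
    by (simp add: frag_def sum_window sum.distrib)
  also have "\<dots> \<le> frag n N c + growth * (\<Sum>i. phi N i * c i)"
    using pair_sum_le[OF assms(1)] by simp
  finally show ?thesis .
qed

section \<open>Iteration and the discrete Gronwall estimate\<close>

text \<open>The factor \<open>Suc n\<close> drives the step to 0, the other one yields the
  positivity condition of \<open>euler_nonneg\<close>; its summand 1 avoids a zero
  denominator.\<close>

definition step :: "nat \<Rightarrow> real" where
  "step n = 1 / (real (Suc n) * (1 + 2 * mass0 * rate_total n))"

primrec iter :: "nat \<Rightarrow> nat \<Rightarrow> nat \<Rightarrow> real" where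
  "iter n 0 = cin"
| "iter n (Suc m) = euler n (step n) (iter n m)"

lemma step_pos: "0 < step n"
  using mass_nonneg rate_total_nonneg[of n] by (simp add: step_def add_pos_nonneg)

lemma step_small: "step n * (2 * mass0 * rate_total n) \<le> 1" "step n \<le> 1 / real (Suc n)"
proof -
  let ?x = "2 * mass0 * rate_total n"
  have x: "0 \<le> ?x" using mass_nonneg rate_total_nonneg[of n] by simp
  have "1 * (1 + ?x) \<le> real (Suc n) * (1 + ?x)" using x by (intro mult_right_mono) auto
  then have *: "?x \<le> real (Suc n) * (1 + ?x)" by simp
  have p: "0 < real (Suc n) * (1 + ?x)" using x by (simp add: add_pos_nonneg)
  show "step n * ?x \<le> 1"
    unfolding step_def using * p by (simp add: divide_le_eq_1_pos)
  have "real (Suc n) * 1 \<le> real (Suc n) * (1 + ?x)" using x by (intro mult_left_mono) auto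
  then show "step n \<le> 1 / real (Suc n)"
    unfolding step_def by (intro divide_left_mono) (use p in auto)
qed

lemma step_tendsto_0: "step \<longlonglongrightarrow> 0"
  by (rule tendsto_sandwich[OF _ _ tendsto_const lim_1_over_n[THEN LIMSEQ_Suc]])
    (use step_pos step_small(2) in \<open>auto intro!: always_eventually less_imp_le\<close>)

lemma admissible_iter: "admissible (iter n m)"
  by (induction m) (simp_all add: admissible_cin euler_admissible step_small step_pos less_imp_le)

text \<open>Discrete Gronwall from \<open>moment_rate\<close>. The accumulated fragmentation stays
  on the left, so the moment and the dissipation are bounded together.\<close>

lemma moment_iter:
  assumes "2 \<le> N"
  shows "(\<Sum>i. phi N i * iter n m i) + step n / 2 * (\<Sum>l<m. frag n N (iter n l))
    \<le> (1 + growth * step n) ^ m * (\<Sum>i. phi N i * cin i)"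
proof (induction m)
  case (Suc m)
  let ?M = "\<Sum>i. phi N i * iter n m i" and ?S = "\<Sum>l<m. frag n N (iter n l)"
  let ?g = "growth * step n"
  have "0 \<le> ?S" using frag_nonneg admissible_iter by (intro sum_nonneg) auto
  \<comment> \<open>The surplus created when the accumulated dissipation is multiplied by
    \<open>1 + ?g\<close>; being nonnegative, it may be added on the right.\<close>
  then have S: "0 \<le> ?g * (step n / 2 * ?S)"
    using mass_nonneg step_pos[of n] by simp
  have "(\<Sum>i. phi N i * iter n (Suc m) i)
      = ?M + step n * (\<Sum>e\<in>window n. flux (iter n m) e * gap (phi N) e)"
    using euler_sums[where n = n and h = "step n", OF summable_phi[OF admissible_iter[of n m], of N]] by (simp add: sums_iff)
  moreover have "step n * ((\<Sum>e\<in>window n. flux (iter n m) e * gap (phi N) e) + frag n N (iter n m) / 2)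
     \<le> step n * (growth * ?M)"
    using step_pos[of n] by (intro mult_left_mono moment_rate admissible_iter assms) auto
  moreover have "(1 + ?g) * (?M + step n / 2 * ?S)
      = ?M + step n / 2 * ?S + step n * (growth * ?M) + ?g * (step n / 2 * ?S)"
    by (simp add: algebra_simps)
  ultimately have "(\<Sum>i. phi N i * iter n (Suc m) i) + step n / 2 * (\<Sum>l<Suc m. frag n N (iter n l))
     \<le> (1 + ?g) * (?M + step n / 2 * ?S)"
    using S unfolding sum.lessThan_Suc distrib_left by linarith
  also have "\<dots> \<le> (1 + ?g) * ((1 + ?g) ^ m * (\<Sum>i. phi N i * cin i))"
    using mass_nonneg step_pos[of n] by (intro mult_left_mono Suc) auto
  finally show ?case by (simp add: mult_ac)
qed simp

text \<open>The exponential is the Gronwall factor, 2 accounts for \<open>frag\<close>, and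
  \<open>growth * T\<close> for the moment summed over time. It does not depend on
  \<open>n\<close>.\<close>

definition tail_bound :: "nat \<Rightarrow> real \<Rightarrow> real" where
  "tail_bound N T = (2 + growth * T) * exp (growth * T) * (\<Sum>i. phi N i * cin i)"

lemma tail_bound_tendsto_0: "(\<lambda>N. tail_bound N T) \<longlonglongrightarrow> 0"
  unfolding tail_bound_def
  using tendsto_mult[OF tendsto_const phi_vanishes[OF summable_cin(2) cin_nonneg]] by simp

text \<open>Sums \<open>tail_flux_le\<close> over time: \<open>moment_iter\<close> bounds the moment
  at each step and also the total of \<open>frag\<close>.\<close>

lemma tail_flux_iter:
  assumes "2 \<le> N" "real m * step n \<le> T"
  shows "step n * (\<Sum>l<m. \<Sum>e\<in>window n - window N. flux (iter n l) e) \<le> tail_bound N T"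
proof -
  let ?h = "step n" and ?eps = "\<Sum>i. phi N i * cin i"
  have eps: "0 \<le> ?eps" by (intro suminf_nonneg summable_phi admissible_cin) (simp add: cin_nonneg)
  have T: "0 \<le> T" using assms step_pos[of n] by (meson mult_nonneg_nonneg less_imp_le of_nat_0_le_iff order_trans)
  have pow: "(1 + growth * ?h) ^ l \<le> exp (growth * T)" if "l \<le> m" for l
  proof -
    have "(1 + growth * ?h) ^ l \<le> exp (growth * ?h) ^ l"
      using mass_nonneg step_pos[of n] by (intro power_mono exp_ge_add_one_self) auto
    also have "\<dots> = exp (growth * (real l * ?h))" by (simp add: exp_of_nat_mult[symmetric] mult_ac)
    also have "\<dots> \<le> exp (growth * T)"
    proof -
      have "real l * ?h \<le> real m * ?h" using that step_pos[of n] by (intro mult_right_mono) auto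
      then show ?thesis using assms mass_nonneg by (auto intro!: mult_left_mono)
    qed
    finally show ?thesis .
  qed
  have M: "(\<Sum>i. phi N i * iter n l i) \<le> exp (growth * T) * ?eps" if "l \<le> m" for l
  proof -
    have "0 \<le> ?h / 2 * (\<Sum>j<l. frag n N (iter n j))"
      using frag_nonneg admissible_iter step_pos[of n] by (intro mult_nonneg_nonneg sum_nonneg) auto
    then have "(\<Sum>i. phi N i * iter n l i) \<le> (1 + growth * ?h) ^ l * ?eps"
      using moment_iter[OF assms(1), of n l] by linarith
    also have "\<dots> \<le> exp (growth * T) * ?eps" using pow[OF that] eps by (rule mult_right_mono)
    finally show ?thesis .
  qed
  have F: "?h * (\<Sum>l<m. frag n N (iter n l)) \<le> 2 * (exp (growth * T) * ?eps)"
  proof -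
    have "0 \<le> (\<Sum>i. phi N i * iter n m i)"
      using admissible_iter by (intro suminf_nonneg summable_phi) (auto simp: admissible_def)
    then have "?h / 2 * (\<Sum>l<m. frag n N (iter n l)) \<le> (1 + growth * ?h) ^ m * ?eps"
      using moment_iter[OF assms(1), of n m] by linarith
    also have "\<dots> \<le> exp (growth * T) * ?eps" using pow[of m] eps by (intro mult_right_mono) auto
    finally show ?thesis by simp
  qed
  have "?h * (\<Sum>l<m. \<Sum>e\<in>window n - window N. flux (iter n l) e)
    \<le> ?h * (\<Sum>l<m. frag n N (iter n l) + growth * (exp (growth * T) * ?eps))"
  proof (intro mult_left_mono sum_mono)
    fix l assume "l \<in> {..<m}"
    then have "growth * (\<Sum>i. phi N i * iter n l i) \<le> growth * (exp (growth * T) * ?eps)"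
      by (intro mult_left_mono M mass_nonneg) auto
    moreover have "(\<Sum>e\<in>window n - window N. flux (iter n l) e)
      \<le> frag n N (iter n l) + growth * (\<Sum>i. phi N i * iter n l i)"
      using assms by (intro tail_flux_le admissible_iter) auto
    ultimately show "(\<Sum>e\<in>window n - window N. flux (iter n l) e)
      \<le> frag n N (iter n l) + growth * (exp (growth * T) * ?eps)" by linarith
  qed (use step_pos[of n] in auto)
  also have "\<dots> = ?h * (\<Sum>l<m. frag n N (iter n l)) + (real m * ?h) * (growth * (exp (growth * T) * ?eps))"
    by (simp add: sum.distrib algebra_simps)
  also have "\<dots> \<le> 2 * (exp (growth * T) * ?eps) + T * (growth * (exp (growth * T) * ?eps))"
    using mass_nonneg eps by (intro add_mono F mult_right_mono assms) auto
  also have "\<dots> = tail_bound N T" by (simp add: tail_bound_def algebra_simps)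
  finally show ?thesis .
qed

end

subsection \<open>Infinite sums of integrals and integrals of step functions\<close>

text \<open>Bolzano-Weierstrass for one index at a time, then a diagonal sequence over the numbering
  \<open>to_nat\<close>.\<close>

lemma convergent_subseq_pointwise:
  fixes f :: "nat \<Rightarrow> 'k::countable \<Rightarrow> real"
  assumes "\<And>n k. \<bar>f n k\<bar> \<le> B"
  shows "\<exists>\<sigma>. strict_mono \<sigma> \<and> (\<forall>k. convergent (\<lambda>n. f (\<sigma> n) k))"
proof -
  let ?P = "\<lambda>m s. convergent (\<lambda>n. f (s n) (from_nat m))"
  interpret subseqs ?P
  proof
    fix m and s :: "nat \<Rightarrow> nat"
    have "bounded (range (\<lambda>n. f (s n) (from_nat m)))"
      using assms by (auto simp: bounded_iff)
    from bounded_imp_convergent_subsequence[OF this]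
    show "\<exists>r'. strict_mono r' \<and> ?P m (s \<circ> r')"
      by (auto simp: convergent_def o_def)
  qed
  have "convergent (\<lambda>n. f (diagseq n) k)" for k
  proof -
    \<comment> \<open>The diagonal is a subsequence of the stage treating \<open>k\<close> only from
      that stage on, hence the shift.\<close>
    have "?P (to_nat k) (diagseq \<circ> (+) (Suc (to_nat k)))"
    proof (rule diagseq_holds)
      fix r s :: "nat \<Rightarrow> nat" and m
      assume "strict_mono r" "?P m s"
      then show "?P m (s \<circ> r)"
        using convergent_subseq_convergent[of "\<lambda>n. f (s n) (from_nat m)" r] by (simp add: o_def)
    qed
    then have "convergent (\<lambda>n. f (diagseq (n + Suc (to_nat k))) k)"
      by (simp add: o_def add_ac)
    then show ?thesis
      using convergent_ignore_initial_segment[of "\<lambda>n. f (diagseq n) k" "Suc (to_nat k)"] by simp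
  qed
  with subseq_diagseq show ?thesis by blast
qed

text \<open>Extension by zero along the numbering \<open>to_nat\<close>. It turns
  \<open>infsum\<close> over a countable set into an ordinary series, for which monotone convergence
  and termwise integration are available.\<close>

definition reindex :: "'k::countable set \<Rightarrow> ('k \<Rightarrow> real) \<Rightarrow> nat \<Rightarrow> real" where
  "reindex A g n = (if n \<in> to_nat ` A then g (from_nat n) else 0)"

lemma summable_on_iff_reindex:
  fixes g :: "'k::countable \<Rightarrow> real"
  assumes "\<And>k. k \<in> A \<Longrightarrow> 0 \<le> g k"
  shows "g summable_on A \<longleftrightarrow> summable (reindex A g)"
    and "summable (reindex A g) \<Longrightarrow> infsum g A = suminf (reindex A g)"
proof -
  have inj: "inj_on (to_nat :: 'k \<Rightarrow> nat) A" by simp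
  have nn: "\<And>n. 0 \<le> reindex A g n" using assms by (auto simp: reindex_def)
  have "g summable_on A \<longleftrightarrow> (g \<circ> from_nat) summable_on (to_nat ` A)"
    using summable_on_reindex[OF inj, of "g \<circ> from_nat"] by (simp add: o_def)
  also have "\<dots> \<longleftrightarrow> reindex A g summable_on UNIV"
    by (rule summable_on_cong_neutral) (auto simp: reindex_def)
  also have "\<dots> \<longleftrightarrow> summable (reindex A g)"
    using nn by (rule summable_on_UNIV_nonneg_real_iff)
  finally show eq: "g summable_on A \<longleftrightarrow> summable (reindex A g)" .
  assume s: "summable (reindex A g)"
  then have "reindex A g summable_on UNIV"
    using summable_on_UNIV_nonneg_real_iff[of "reindex A g"] nn by simp
  from has_sum_imp_sums[OF has_sum_infsum[OF this]]
  have S: "infsum (reindex A g) UNIV = suminf (reindex A g)" by (simp add: sums_iff)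
  have "infsum g A = infsum (g \<circ> from_nat) (to_nat ` A)"
    using infsum_reindex[OF inj, of "g \<circ> from_nat"] by (simp add: o_def)
  also have "\<dots> = infsum (reindex A g) UNIV"
    by (rule infsum_cong_neutral) (auto simp: reindex_def)
  also note S
  finally show "infsum g A = suminf (reindex A g)" .
qed

text \<open>No convergence is needed here: for a divergent series both sides are \<open>0\<close>.\<close>

lemma infsum_eq_enn2real:
  fixes g :: "'k::countable \<Rightarrow> real"
  assumes "\<And>k. k \<in> A \<Longrightarrow> 0 \<le> g k"
  shows "infsum g A = enn2real (\<Sum>n. ennreal (reindex A g n))"
proof -
  have nn: "\<And>n. 0 \<le> reindex A g n" using assms by (auto simp: reindex_def)
  show ?thesis
  proof (cases "summable (reindex A g)")
    case True
    then show ?thesis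
      using summable_on_iff_reindex(2)[OF assms True] suminf_ennreal2[OF nn True] nn
      by (simp add: suminf_nonneg)
  next
    case False
    then have "(\<Sum>n. ennreal (reindex A g n)) = top" using summable_suminf_not_top nn by blast
    moreover have "infsum g A = 0"
      using False summable_on_iff_reindex(1)[of A g, OF assms] by (simp add: infsum_not_exists)
    ultimately show ?thesis by simp
  qed
qed

lemma borel_measurable_reindex:
  assumes "\<And>k. k \<in> A \<Longrightarrow> w k \<in> borel_measurable M"
  shows "(\<lambda>x. reindex A (\<lambda>k. w k x) n) \<in> borel_measurable M"
  using assms by (cases "n \<in> to_nat ` A") (auto simp: reindex_def)

text \<open>Through \<open>infsum_eq_enn2real\<close> the sum is measurable everywhere, including
  the points where it diverges and has the default value 0.\<close>

lemma borel_measurable_infsum: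
  fixes w :: "'k::countable \<Rightarrow> 'm \<Rightarrow> real"
  assumes "\<And>k. k \<in> A \<Longrightarrow> w k \<in> borel_measurable M" "\<And>k x. k \<in> A \<Longrightarrow> 0 \<le> w k x"
  shows "(\<lambda>x. infsum (\<lambda>k. w k x) A) \<in> borel_measurable M"
proof -
  note [measurable] = borel_measurable_reindex[OF assms(1)]
  have "(\<lambda>x. enn2real (\<Sum>n. ennreal (reindex A (\<lambda>k. w k x) n))) \<in> borel_measurable M"
    by measurable
  then show ?thesis using assms(2) by (simp add: infsum_eq_enn2real)
qed

text \<open>Tonelli for a countable nonnegative family: a finite sum of integrals makes the sum of
  the functions finite almost everywhere.\<close>

lemma
  fixes w :: "'k::countable \<Rightarrow> 'm \<Rightarrow> real"
  assumes int: "\<And>k. k \<in> A \<Longrightarrow> integrable M (w k)" and nonneg: "\<And>k x. k \<in> A \<Longrightarrow> 0 \<le> w k x"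
    and summ: "(\<lambda>k. integral\<^sup>L M (w k)) summable_on A"
  shows AE_summable_on: "AE x in M. (\<lambda>k. w k x) summable_on A"
    and integrable_infsum: "integrable M (\<lambda>x. infsum (\<lambda>k. w k x) A)"
    and integral_infsum: "integral\<^sup>L M (\<lambda>x. infsum (\<lambda>k. w k x) A) = infsum (\<lambda>k. integral\<^sup>L M (w k)) A"
proof -
  let ?g = "\<lambda>n x. reindex A (\<lambda>k. w k x) n"
  have nn: "\<And>n x. 0 \<le> ?g n x" using nonneg by (auto simp: reindex_def)
  have meas: "\<And>n. ?g n \<in> borel_measurable M"
    using int by (intro borel_measurable_reindex) auto
  have gi: "integrable M (?g n)" for n
    using int by (cases "n \<in> to_nat ` A") (auto simp: reindex_def)
  have gI: "integral\<^sup>L M (?g n) = reindex A (\<lambda>k. integral\<^sup>L M (w k)) n" for n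
    by (simp add: reindex_def)
  have In: "\<And>k. k \<in> A \<Longrightarrow> 0 \<le> integral\<^sup>L M (w k)" using nonneg by simp
  have sI: "summable (reindex A (\<lambda>k. integral\<^sup>L M (w k)))"
    using summable_on_iff_reindex(1)[of A "\<lambda>k. integral\<^sup>L M (w k)"] In summ by simp
  have "(\<integral>\<^sup>+x. (\<Sum>n. ennreal (?g n x)) \<partial>M) = (\<Sum>n. \<integral>\<^sup>+x. ennreal (?g n x) \<partial>M)"
    using meas by (intro nn_integral_suminf) simp
  also have "\<dots> = (\<Sum>n. ennreal (integral\<^sup>L M (?g n)))"
    using gi nn by (intro suminf_cong nn_integral_eq_integral) auto
  also have "\<dots> \<noteq> top"
    unfolding gI by (rule ennreal_suminf_neq_top[OF sI]) (use In in \<open>auto simp only: reindex_def from_nat_to_nat split: if_splits\<close>)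
  finally have "(\<integral>\<^sup>+x. (\<Sum>n. ennreal (?g n x)) \<partial>M) \<noteq> \<infinity>" by simp
  then have "AE x in M. (\<Sum>n. ennreal (?g n x)) \<noteq> \<infinity>"
    using meas by (intro nn_integral_PInf_AE) auto
  then have AEs: "AE x in M. summable (\<lambda>n. ?g n x)"
    by eventually_elim (use summable_suminf_not_top nn in auto)
  then show "AE x in M. (\<lambda>k. w k x) summable_on A"
  proof eventually_elim
    case (elim x)
    then show ?case
      using summable_on_iff_reindex(1)[of A "\<lambda>k. w k x"] nonneg by simp
  qed
  have AEn: "AE x in M. summable (\<lambda>n. norm (?g n x))" using AEs nn by simp
  have sn: "summable (\<lambda>n. \<integral>x. norm (?g n x) \<partial>M)" using sI nn by (simp add: gI)
  have eq: "AE x in M. (\<Sum>n. ?g n x) = infsum (\<lambda>k. w k x) A"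
    using AEs
  proof eventually_elim
    case (elim x)
    then show ?case
      using summable_on_iff_reindex(2)[of A "\<lambda>k. w k x"] nonneg by simp
  qed
  have m: "(\<lambda>x. infsum (\<lambda>k. w k x) A) \<in> borel_measurable M"
    using int nonneg by (intro borel_measurable_infsum) auto
  show "integrable M (\<lambda>x. infsum (\<lambda>k. w k x) A)"
    using integrable_cong_AE[THEN iffD1, OF _ m eq] integrable_suminf[OF gi AEn sn] by auto
  have "integral\<^sup>L M (\<lambda>x. infsum (\<lambda>k. w k x) A) = integral\<^sup>L M (\<lambda>x. \<Sum>n. ?g n x)"
    using integral_cong_AE[OF _ m eq] integrable_suminf[OF gi AEn sn] by auto
  also have "\<dots> = (\<Sum>n. integral\<^sup>L M (?g n))"
    by (rule integral_suminf[OF gi AEn sn])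
  also have "\<dots> = infsum (\<lambda>k. integral\<^sup>L M (w k)) A"
    unfolding gI using summable_on_iff_reindex(2)[of A "\<lambda>k. integral\<^sup>L M (w k)"] In sI by simp
  finally show "integral\<^sup>L M (\<lambda>x. infsum (\<lambda>k. w k x) A) = infsum (\<lambda>k. integral\<^sup>L M (w k)) A" .
qed

text \<open>The map \<open>g\<close> enumerates \<open>E\<close> by pairs. Iterated and unordered
  sums agree only where the family is summable, so almost everywhere; measurability of the iterated
  sum is therefore shown separately.\<close>

lemma
  fixes w :: "'e::countable \<Rightarrow> 'm \<Rightarrow> real" and K :: "'k::countable set" and L :: "'k \<Rightarrow> 'l::countable set"
  assumes inj: "inj_on (\<lambda>(k, j). g k j) (Sigma K L)" and img: "(\<lambda>(k, j). g k j) ` Sigma K L = E"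
    and int: "\<And>e. e \<in> E \<Longrightarrow> integrable M (w e)" and nonneg: "\<And>e x. e \<in> E \<Longrightarrow> 0 \<le> w e x"
    and summ: "(\<lambda>e. integral\<^sup>L M (w e)) summable_on E"
  shows AE_summable_on_Sigma: "AE x in M. (\<lambda>(k, j). w (g k j) x) summable_on Sigma K L"
    and integrable_infsum_Sigma: "integrable M (\<lambda>x. \<Sum>\<^sub>\<infinity>k\<in>K. \<Sum>\<^sub>\<infinity>j\<in>L k. w (g k j) x)"
    and integral_infsum_Sigma: "integral\<^sup>L M (\<lambda>x. \<Sum>\<^sub>\<infinity>k\<in>K. \<Sum>\<^sub>\<infinity>j\<in>L k. w (g k j) x)
      = infsum (\<lambda>e. integral\<^sup>L M (w e)) E"
proof -
  have re: "(\<lambda>(k, j). w (g k j) x) = (\<lambda>e. w e x) \<circ> (\<lambda>(k, j). g k j)" for x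
    by auto
  have mem: "g k j \<in> E" if "k \<in> K" "j \<in> L k" for k j using that img by auto
  have AEs: "AE x in M. (\<lambda>e. w e x) summable_on E"
    using int nonneg summ by (rule AE_summable_on)
  then show s: "AE x in M. (\<lambda>(k, j). w (g k j) x) summable_on Sigma K L"
    unfolding re summable_on_reindex[OF inj, symmetric] img .
  have eq: "AE x in M. infsum (\<lambda>e. w e x) E = (\<Sum>\<^sub>\<infinity>k\<in>K. \<Sum>\<^sub>\<infinity>j\<in>L k. w (g k j) x)"
    using s
  proof eventually_elim
    case (elim x)
    show ?case
      unfolding infsum_Sigma'_banach[OF elim] re infsum_reindex[OF inj, symmetric] img ..
  qed
  have m1: "(\<lambda>x. infsum (\<lambda>e. w e x) E) \<in> borel_measurable M"
    using int nonneg by (intro borel_measurable_infsum) auto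
  have m2: "(\<lambda>x. \<Sum>\<^sub>\<infinity>k\<in>K. \<Sum>\<^sub>\<infinity>j\<in>L k. w (g k j) x) \<in> borel_measurable M"
    using int nonneg mem by (intro borel_measurable_infsum infsum_nonneg) auto
  show "integrable M (\<lambda>x. \<Sum>\<^sub>\<infinity>k\<in>K. \<Sum>\<^sub>\<infinity>j\<in>L k. w (g k j) x)"
    using integrable_cong_AE[THEN iffD1, OF m1 m2 eq] integrable_infsum[OF int nonneg summ] by auto
  show "integral\<^sup>L M (\<lambda>x. \<Sum>\<^sub>\<infinity>k\<in>K. \<Sum>\<^sub>\<infinity>j\<in>L k. w (g k j) x) = infsum (\<lambda>e. integral\<^sup>L M (w e)) E"
    using integral_cong_AE[OF m1 m2 eq] integral_infsum[OF int nonneg summ] by auto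
qed

lemma nat_floor_step:
  assumes "(0::real) < h" "h * real m \<le> s" "s < h * real (Suc m)"
  shows "nat \<lfloor>s / h\<rfloor> = m"
proof -
  have "\<lfloor>s / h\<rfloor> = int m" using assms by (intro floor_unique) (auto simp: field_simps)
  then show ?thesis by simp
qed

text \<open>The half-open cells are exactly the level sets of the floor. Time sums of the Euler
  scheme thereby become integrals, to which dominated convergence applies.\<close>

lemma has_bochner_integral_step:
  fixes g :: "nat \<Rightarrow> real"
  assumes h: "0 < h"
  shows "has_bochner_integral lborel (\<lambda>s. indicator {0..<h * real m} s * g (nat \<lfloor>s / h\<rfloor>)) (h * (\<Sum>l<m. g l))"
proof (induction m)
  case (Suc m)
  have "has_bochner_integral lborel (\<lambda>s. indicator {h * real m..<h * real (Suc m)} s *\<^sub>R g m) (h *\<^sub>R g m)"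
    using has_bochner_integral_real_indicator[of "{h * real m..<h * real (Suc m)}" lborel] h
    by (intro has_bochner_integral_scaleR_left) (auto simp: algebra_simps)
  from has_bochner_integral_add[OF Suc this]
  have "has_bochner_integral lborel (\<lambda>s. indicator {0..<h * real m} s * g (nat \<lfloor>s / h\<rfloor>)
      + indicator {h * real m..<h * real (Suc m)} s *\<^sub>R g m) (h * (\<Sum>l<Suc m. g l))"
    by (simp add: algebra_simps)
  moreover have "indicator {0..<h * real m} s * g (nat \<lfloor>s / h\<rfloor>)
      + indicator {h * real m..<h * real (Suc m)} s *\<^sub>R g m
      = indicator {0..<h * real (Suc m)} s * g (nat \<lfloor>s / h\<rfloor>)" for s
  proof -
    have "0 \<le> h * real m" "h * real m \<le> h * real (Suc m)" using h by auto
    then show ?thesis using nat_floor_step[OF h, of m s] by (auto simp: indicator_def)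
  qed
  ultimately show ?case by simp
qed (simp add: has_bochner_integral_zero)

lemma nat_floor_step_bounds:
  assumes "(0::real) < h" "0 \<le> t"
  shows "h * real (nat \<lfloor>t / h\<rfloor>) \<le> t" "t < h * real (nat \<lfloor>t / h\<rfloor>) + h"
proof -
  have f: "real (nat \<lfloor>t / h\<rfloor>) = of_int \<lfloor>t / h\<rfloor>" using assms by simp
  have "h * of_int \<lfloor>t / h\<rfloor> \<le> h * (t / h)"
    using assms by (intro mult_left_mono) auto
  then show "h * real (nat \<lfloor>t / h\<rfloor>) \<le> t" unfolding f using assms by simp
  have "t / h < of_int \<lfloor>t / h\<rfloor> + 1" by linarith
  then show "t < h * real (nat \<lfloor>t / h\<rfloor>) + h"
    using assms unfolding f by (auto simp: field_simps)
qed

subsection \<open>Equicontinuity and passage to the limit\<close>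

lemma abs_gap_unit_mult_le: "0 \<le> x \<Longrightarrow> \<bar>gap (unit_at i) e * x\<bar> \<le> 2 * x"
  by (simp add: abs_mult mult_right_mono abs_gap_unit_le)

context dged
begin

text \<open>Piecewise constant, so that each value is an iterate and hence admissible. At negative
  times \<open>nat\<close> truncates to 0 and the value is \<open>cin\<close>.\<close>

definition approx :: "nat \<Rightarrow> real \<Rightarrow> nat \<Rightarrow> real" where
  "approx n s = iter n (nat \<lfloor>s / step n\<rfloor>)"

text \<open>Flux of one event integrated up to the last grid point before \<open>t\<close>. It is 0
  outside the window, so that it makes sense for every event.\<close>

definition cflux :: "nat \<Rightarrow> real \<Rightarrow> nat \<times> nat \<times> nat \<Rightarrow> real" where
  "cflux n t e = step n * (\<Sum>l<nat \<lfloor>t / step n\<rfloor>. if e \<in> window n then flux (iter n l) e else 0)"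

text \<open>Since \<open>mass0\<close> bounds each component of an admissible sequence, this bounds
  the flux of an event uniformly in time and in \<open>n\<close>.\<close>

definition flux_max :: "nat \<times> nat \<times> nat \<Rightarrow> real" where
  "flux_max = flux (\<lambda>_. mass0)"

lemma flux_le_max: "admissible c \<Longrightarrow> e \<in> events \<Longrightarrow> flux c e \<le> flux_max e"
  using flux_le(3) by (cases e) (auto simp: flux_max_def flux_def)

lemma flux_max_nonneg: "e \<in> events \<Longrightarrow> 0 \<le> flux_max e"
  by (rule order.trans[OF flux_nonneg[OF admissible_cin] flux_le_max[OF admissible_cin]])

lemma admissible_approx: "admissible (approx n s)"
  by (simp add: approx_def admissible_iter)

lemma iter_eq:
  "iter n m i = cin i + step n * (\<Sum>l<m. \<Sum>e\<in>window n. flux (iter n l) e * gap (unit_at i) e)"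
  by (induction m) (simp_all add: euler_def algebra_simps)

lemma approx_eq: "approx n t i = cin i + (\<Sum>e\<in>window n. gap (unit_at i) e * cflux n t e)"
proof -
  let ?m = "nat \<lfloor>t / step n\<rfloor>"
  have "step n * (\<Sum>l<?m. \<Sum>e\<in>window n. flux (iter n l) e * gap (unit_at i) e)
    = step n * (\<Sum>e\<in>window n. \<Sum>l<?m. flux (iter n l) e * gap (unit_at i) e)"
    by (subst sum.swap) simp
  also have "\<dots> = (\<Sum>e\<in>window n. gap (unit_at i) e * cflux n t e)"
    unfolding cflux_def sum_distrib_left by (intro sum.cong) (auto simp: mult_ac)
  finally show ?thesis unfolding approx_def iter_eq[of n ?m] by simp
qed

lemma flux_iter_nonneg: "0 \<le> (if e \<in> window n then flux (iter n l) e else 0)"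
  using flux_nonneg[OF admissible_iter] subsetD[OF window_subset_events] by auto

lemma cflux_nonneg: "0 \<le> cflux n t e"
  unfolding cflux_def using step_pos[of n] flux_iter_nonneg by (simp add: sum_nonneg)

lemma cflux_mono:
  assumes "s \<le> t"
  shows "cflux n s e \<le> cflux n t e"
proof -
  have "nat \<lfloor>s / step n\<rfloor> \<le> nat \<lfloor>t / step n\<rfloor>"
    using assms step_pos[of n] by (intro nat_mono floor_mono divide_right_mono) auto
  then show ?thesis
    unfolding cflux_def using step_pos[of n] flux_iter_nonneg
    by (intro mult_left_mono sum_mono2) auto
qed

text \<open>The additional \<open>step n\<close> comes from rounding both times down to the
  grid.\<close>

lemma cflux_increment:
  assumes "0 \<le> s" "s \<le> t" "e \<in> events"
  shows "cflux n t e - cflux n s e \<le> (t - s + step n) * flux_max e"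
proof -
  let ?f = "\<lambda>l. if e \<in> window n then flux (iter n l) e else 0"
  define u v where "u = nat \<lfloor>s / step n\<rfloor>" and "v = nat \<lfloor>t / step n\<rfloor>"
  have uv: "u \<le> v"
    unfolding u_def v_def using assms step_pos[of n] by (intro nat_mono floor_mono divide_right_mono) auto
  have "{..<v} = {..<u} \<union> {u..<v}" using uv by auto
  then have "(\<Sum>l<v. ?f l) = (\<Sum>l<u. ?f l) + (\<Sum>l\<in>{u..<v}. ?f l)"
    by (simp add: sum.union_disjoint ivl_disj_int)
  then have "cflux n t e - cflux n s e = step n * (\<Sum>l\<in>{u..<v}. ?f l)"
    by (simp add: cflux_def u_def[symmetric] v_def[symmetric] algebra_simps)
  also have "\<dots> \<le> step n * (\<Sum>l\<in>{u..<v}. flux_max e)"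
    using step_pos[of n] flux_le_max[OF admissible_iter assms(3)] flux_max_nonneg[OF assms(3)]
    by (intro mult_left_mono sum_mono) auto
  also have "\<dots> = (step n * real v - step n * real u) * flux_max e"
    using uv by (simp add: of_nat_diff algebra_simps)
  also have "\<dots> \<le> (t - s + step n) * flux_max e"
    using nat_floor_step_bounds[OF step_pos[of n], of s] nat_floor_step_bounds[OF step_pos[of n], of t]
      assms by (intro mult_right_mono flux_max_nonneg) (auto simp: u_def v_def)
  finally show ?thesis .
qed

text \<open>For arbitrary finite \<open>A\<close> independent of \<open>n\<close>, so that the bound
  can pass to the limit term by term.\<close>

lemma cflux_tail:
  assumes "2 \<le> N" "0 \<le> t" "t \<le> T" "finite A" "A \<subseteq> events - window N"
  shows "(\<Sum>e\<in>A. cflux n t e) \<le> tail_bound N T"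
proof -
  let ?m = "nat \<lfloor>t / step n\<rfloor>"
  have "(\<Sum>e\<in>A. cflux n t e) = step n * (\<Sum>e\<in>A. \<Sum>l<?m. if e \<in> window n then flux (iter n l) e else 0)"
    by (simp add: cflux_def sum_distrib_left)
  also have "\<dots> = step n * (\<Sum>l<?m. \<Sum>e\<in>A. if e \<in> window n then flux (iter n l) e else 0)"
    by (subst sum.swap) simp
  also have "\<dots> \<le> step n * (\<Sum>l<?m. \<Sum>e\<in>window n - window N. flux (iter n l) e)"
  proof (intro mult_left_mono sum_mono)
    fix l
    have "(\<Sum>e\<in>A. if e \<in> window n then flux (iter n l) e else 0) = (\<Sum>e\<in>A \<inter> window n. flux (iter n l) e)"
      using assms(4) by (simp add: sum.inter_restrict)
    also have "\<dots> \<le> (\<Sum>e\<in>window n - window N. flux (iter n l) e)"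
      using assms(5) flux_nonneg[OF admissible_iter] subsetD[OF window_subset_events]
      by (intro sum_mono2) auto
    finally show "(\<Sum>e\<in>A. if e \<in> window n then flux (iter n l) e else 0)
      \<le> (\<Sum>e\<in>window n - window N. flux (iter n l) e)" .
  qed (use step_pos[of n] in auto)
  also have "\<dots> \<le> tail_bound N T"
    using nat_floor_step_bounds(1)[OF step_pos[of n] assms(2)] assms
    by (intro tail_flux_iter) (auto simp: mult.commute)
  finally show ?thesis .
qed

definition flux_sum :: "nat \<Rightarrow> real" where
  "flux_sum N = (\<Sum>e\<in>window N. flux_max e)"

lemma flux_sum_nonneg: "0 \<le> flux_sum N"
  unfolding flux_sum_def using flux_max_nonneg subsetD[OF window_subset_events] by (intro sum_nonneg) auto

text \<open>Events inside \<open>window N\<close> have bounded rates and contribute a Lipschitz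
  term; those outside are uniformly small in total. Each event changes a component by at most 2. The
  jumps leave the error \<open>step n\<close>.\<close>

lemma approx_increment:
  assumes "0 \<le> s" "s \<le> t" "t \<le> T" "2 \<le> N"
  shows "\<bar>approx n t i - approx n s i\<bar> \<le> 2 * ((t - s + step n) * flux_sum N + tail_bound N T)"
proof -
  let ?d = "\<lambda>e. cflux n t e - cflux n s e"
  have d: "0 \<le> ?d e" for e using cflux_mono[OF assms(2)] by simp
  have "\<bar>approx n t i - approx n s i\<bar> = \<bar>\<Sum>e\<in>window n. gap (unit_at i) e * ?d e\<bar>"
    by (simp add: approx_eq sum_subtractf right_diff_distrib)
  also have "\<dots> \<le> (\<Sum>e\<in>window n. 2 * ?d e)"
    using d by (intro order.trans[OF sum_abs] sum_mono abs_gap_unit_mult_le)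
  also have "\<dots> \<le> (\<Sum>e\<in>window N \<union> (window n - window N). 2 * ?d e)"
    by (intro sum_mono2) (use d in auto)
  also have "\<dots> = 2 * ((\<Sum>e\<in>window N. ?d e) + (\<Sum>e\<in>window n - window N. ?d e))"
    by (subst sum.union_disjoint) (auto simp: sum_distrib_left)
  also have "\<dots> \<le> 2 * ((t - s + step n) * flux_sum N + tail_bound N T)"
  proof (intro mult_left_mono add_mono)
    show "(\<Sum>e\<in>window N. ?d e) \<le> (t - s + step n) * flux_sum N"
      unfolding flux_sum_def sum_distrib_left
      using cflux_increment[OF assms(1,2)] subsetD[OF window_subset_events] by (intro sum_mono) auto
    have "(\<Sum>e\<in>window n - window N. ?d e) \<le> (\<Sum>e\<in>window n - window N. cflux n t e)"
      using cflux_nonneg by (intro sum_mono) simp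
    also have "\<dots> \<le> tail_bound N T"
      using assms window_subset_events by (intro cflux_tail) auto
    finally show "(\<Sum>e\<in>window n - window N. ?d e) \<le> tail_bound N T" .
  qed simp
  finally show ?thesis .
qed

lemma small_tail:
  assumes "0 < \<epsilon>"
  obtains N where "2 \<le> N" "tail_bound N T < \<epsilon>"
proof -
  have "\<forall>\<^sub>F N in sequentially. tail_bound N T < \<epsilon> \<and> 2 \<le> N"
    using order_tendstoD(2)[OF tail_bound_tendsto_0 assms] eventually_ge_at_top[of 2]
    by (rule eventually_conj)
  then show ?thesis using that by (auto simp: eventually_sequentially)
qed

text \<open>A diagonal subsequence converges at all rational times and all sizes;
  \<open>approx_increment\<close> transfers the Cauchy property to real times.\<close>

lemma approx_subseq:
  "\<exists>\<sigma> c. strict_mono \<sigma> \<and> (\<forall>t i. (\<lambda>n. approx (\<sigma> n) t i) \<longlonglongrightarrow> c t i)"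
proof -
  have "\<bar>approx n (real_of_rat (fst z)) (snd z)\<bar> \<le> mass0" for n z
    using admissible_approx[of n "real_of_rat (fst z)"] admissible_le by (auto simp: admissible_def)
  from convergent_subseq_pointwise[of "\<lambda>n z. approx n (real_of_rat (fst z)) (snd z)", OF this]
  obtain \<sigma> where \<sigma>: "strict_mono \<sigma>"
    and conv: "\<And>z. convergent (\<lambda>n. approx (\<sigma> n) (real_of_rat (fst z)) (snd z))" by blast
  have step0: "(\<lambda>n. step (\<sigma> n)) \<longlonglongrightarrow> 0"
    using LIMSEQ_subseq_LIMSEQ[OF step_tendsto_0 \<sigma>] by (simp add: o_def)
  have "convergent (\<lambda>n. approx (\<sigma> n) t i)" for t i
  proof (cases "t < 0")
    case True
    have "approx n t = cin" for n
    proof -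
      have "t / step n < 0" using True step_pos[of n] by (simp add: divide_neg_pos)
      then show ?thesis by (simp add: approx_def)
    qed
    then show ?thesis by (simp add: convergent_const)
  next
    case False
    have "Cauchy (\<lambda>n. approx (\<sigma> n) t i)"
    proof (rule metric_CauchyI)
      fix \<epsilon> :: real assume \<epsilon>: "0 < \<epsilon>"
      \<comment> \<open>Error budget: the time term, with \<open>2 * \<delta>\<close> for the
        distance and the step, and the tail each get \<open>\<epsilon> / 12\<close>; doubled, they
        give \<open>\<epsilon> / 3\<close>. The horizon \<open>t + 1\<close> suffices because
        \<open>\<delta> \<le> 1\<close>.\<close>
      obtain N where N: "2 \<le> N" "tail_bound N (t + 1) < \<epsilon> / 12" using small_tail[of "\<epsilon> / 12"] \<epsilon> by auto
      define \<delta> where "\<delta> = min 1 (\<epsilon> / (24 * (flux_sum N + 1)))"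
      have \<delta>: "0 < \<delta>" "\<delta> \<le> 1" using \<epsilon> flux_sum_nonneg[of N] by (auto simp: \<delta>_def add_nonneg_pos)
      have \<delta>B: "2 * \<delta> * flux_sum N \<le> \<epsilon> / 12"
      proof -
        have "2 * \<delta> * flux_sum N \<le> 2 * (\<epsilon> / (24 * (flux_sum N + 1))) * (flux_sum N + 1)"
          using flux_sum_nonneg[of N] \<delta> \<epsilon> by (intro mult_mono) (auto simp: \<delta>_def)
        also have "\<dots> = \<epsilon> / 12" using flux_sum_nonneg[of N] by (simp add: field_simps)
        finally show ?thesis .
      qed
      obtain q' where q': "t < real_of_rat q'" "real_of_rat q' < t + \<delta>"
        using of_rat_dense[of t "t + \<delta>"] \<delta> by auto
      have close: "\<forall>\<^sub>F n in sequentially. \<bar>approx (\<sigma> n) (real_of_rat q') i - approx (\<sigma> n) t i\<bar> \<le> \<epsilon> / 3"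
        using order_tendstoD(2)[OF step0 \<delta>(1)]
      proof eventually_elim
        case (elim n)
        have "\<bar>approx (\<sigma> n) (real_of_rat q') i - approx (\<sigma> n) t i\<bar>
          \<le> 2 * ((real_of_rat q' - t + step (\<sigma> n)) * flux_sum N + tail_bound N (t + 1))"
          using False q' \<delta> N by (intro approx_increment) auto
        also have "\<dots> \<le> 2 * (2 * \<delta> * flux_sum N + tail_bound N (t + 1))"
          using elim q' flux_sum_nonneg[of N] by (intro mult_left_mono add_mono mult_right_mono) auto
        also have "\<dots> \<le> \<epsilon> / 3" using \<delta>B N by simp
        finally show ?case .
      qed
      have "Cauchy (\<lambda>n. approx (\<sigma> n) (real_of_rat q') i)"
        using conv[of "(q', i)"] by (simp add: convergent_Cauchy)
      then obtain M1 where M1: "\<And>m n. M1 \<le> m \<Longrightarrow> M1 \<le> n \<Longrightarrow>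
          dist (approx (\<sigma> m) (real_of_rat q') i) (approx (\<sigma> n) (real_of_rat q') i) < \<epsilon> / 3"
        using metric_CauchyD[of "\<lambda>n. approx (\<sigma> n) (real_of_rat q') i" "\<epsilon> / 3"] \<epsilon> by auto
      from close obtain M2 where M2: "\<And>n. M2 \<le> n \<Longrightarrow>
          \<bar>approx (\<sigma> n) (real_of_rat q') i - approx (\<sigma> n) t i\<bar> \<le> \<epsilon> / 3"
        by (auto simp: eventually_sequentially)
      show "\<exists>M. \<forall>m\<ge>M. \<forall>n\<ge>M. dist (approx (\<sigma> m) t i) (approx (\<sigma> n) t i) < \<epsilon>"
      proof (intro exI[of _ "max M1 M2"] allI impI)
        fix m n assume "max M1 M2 \<le> m" "max M1 M2 \<le> n"
        then have "M1 \<le> m" "M1 \<le> n" "M2 \<le> m" "M2 \<le> n" by auto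
        from M1[OF this(1,2)] M2[OF this(3)] M2[OF this(4)]
        show "dist (approx (\<sigma> m) t i) (approx (\<sigma> n) t i) < \<epsilon>"
          unfolding dist_real_def by linarith
      qed
    qed
    then show ?thesis by (rule Cauchy_convergent)
  qed
  then have "(\<lambda>n. approx (\<sigma> n) t i) \<longlonglongrightarrow> lim (\<lambda>n. approx (\<sigma> n) t i)" for t i
    by (simp add: convergent_LIMSEQ_iff)
  then have "\<forall>t i. (\<lambda>n. approx (\<sigma> n) t i) \<longlonglongrightarrow> (\<lambda>t i. lim (\<lambda>n. approx (\<sigma> n) t i)) t i"
    by blast
  with \<sigma> show ?thesis by (intro exI conjI)
qed

end

section \<open>The limit function and its integrated fluxes\<close>

locale dged_limit = dged +
  fixes \<sigma> :: "nat \<Rightarrow> nat" and c :: "real \<Rightarrow> nat \<Rightarrow> real"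
  assumes \<sigma>: "strict_mono \<sigma>"
    and approx_lim: "\<And>t i. (\<lambda>n. approx (\<sigma> n) t i) \<longlonglongrightarrow> c t i"
begin

lemma step_lim: "(\<lambda>n. step (\<sigma> n)) \<longlonglongrightarrow> 0"
  using LIMSEQ_subseq_LIMSEQ[OF step_tendsto_0 \<sigma>] by (simp add: o_def)

lemma c_nonneg: "0 \<le> c t i"
  using approx_lim by (rule LIMSEQ_le_const) (use admissible_approx in \<open>auto simp: admissible_def\<close>)

text \<open>A Fatou argument: partial sums of the approximations are at most
  \<open>mass0 + mass1\<close>, and this survives the pointwise limit.\<close>

lemma c_X01_plus: "c t \<in> X01_plus"
proof -
  have "summable (\<lambda>i. (1 + real i) * c t i)"
  proof (rule bounded_imp_summable)
    fix m
    have "(\<lambda>n. \<Sum>i\<le>m. (1 + real i) * approx (\<sigma> n) t i) \<longlonglongrightarrow> (\<Sum>i\<le>m. (1 + real i) * c t i)"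
      by (intro tendsto_sum tendsto_mult tendsto_const approx_lim)
    moreover have "(\<Sum>i\<le>m. (1 + real i) * approx (\<sigma> n) t i) \<le> mass0 + mass1" for n
    proof -
      have p: "(\<lambda>i. (1 + real i) * approx (\<sigma> n) t i) sums (mass0 + mass1)"
        using admissible_approx[of "\<sigma> n" t]
          sums_add[of "approx (\<sigma> n) t" mass0 "\<lambda>i. real i * approx (\<sigma> n) t i" mass1]
        by (simp add: admissible_def distrib_right)
      have "(\<Sum>i\<le>m. (1 + real i) * approx (\<sigma> n) t i) \<le> (\<Sum>i. (1 + real i) * approx (\<sigma> n) t i)"
        using p admissible_approx[of "\<sigma> n" t]
        by (intro sum_le_suminf) (auto simp: admissible_def sums_iff)
      then show ?thesis using p by (simp add: sums_iff)
    qed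
    ultimately show "(\<Sum>i\<le>m. (1 + real i) * c t i) \<le> mass0 + mass1"
      by (intro LIMSEQ_le_const2) auto
  qed (simp add: c_nonneg)
  then show ?thesis using c_nonneg by (simp add: X01_plus_def X01_def)
qed

lemma c_0: "c 0 = cin"
proof
  fix i
  have "(\<lambda>n. cin i) \<longlonglongrightarrow> c 0 i" using approx_lim[of 0 i] by (simp add: approx_def)
  then show "c 0 i = cin i" by (rule LIMSEQ_unique[OF _ tendsto_const])
qed

text \<open>The grid error in \<open>approx_increment\<close> vanishes in the limit, which leaves a
  genuine modulus of continuity.\<close>

lemma c_increment:
  assumes "0 \<le> s" "s \<le> t" "t \<le> T" "2 \<le> N"
  shows "\<bar>c t i - c s i\<bar> \<le> 2 * ((t - s) * flux_sum N + tail_bound N T)"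
proof (rule LIMSEQ_le)
  show "(\<lambda>n. \<bar>approx (\<sigma> n) t i - approx (\<sigma> n) s i\<bar>) \<longlonglongrightarrow> \<bar>c t i - c s i\<bar>"
    by (intro tendsto_intros approx_lim)
  have "(\<lambda>n. 2 * ((t - s + step (\<sigma> n)) * flux_sum N + tail_bound N T))
    \<longlonglongrightarrow> 2 * ((t - s + 0) * flux_sum N + tail_bound N T)"
    by (intro tendsto_intros step_lim)
  then show "(\<lambda>n. 2 * ((t - s + step (\<sigma> n)) * flux_sum N + tail_bound N T))
    \<longlonglongrightarrow> 2 * ((t - s) * flux_sum N + tail_bound N T)" by simp
qed (use approx_increment[OF assms] in auto)

lemma c_continuous: "continuous_on {0..} (\<lambda>t. c t i)"
proof (rule continuous_onI)
  fix t \<epsilon> :: real assume t: "t \<in> {0..}" and \<epsilon>: "0 < \<epsilon>"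
  obtain N where N: "2 \<le> N" "tail_bound N (t + 1) < \<epsilon> / 4" using small_tail[of "\<epsilon> / 4"] \<epsilon> by auto
  define \<delta> where "\<delta> = min 1 (\<epsilon> / (4 * (flux_sum N + 1)))"
  have \<delta>: "0 < \<delta>" "\<delta> \<le> 1" using \<epsilon> flux_sum_nonneg[of N] by (auto simp: \<delta>_def add_nonneg_pos)
  have \<delta>B: "\<delta> * flux_sum N \<le> \<epsilon> / 4"
  proof -
    have "\<delta> * flux_sum N \<le> (\<epsilon> / (4 * (flux_sum N + 1))) * (flux_sum N + 1)"
      using flux_sum_nonneg[of N] \<delta> \<epsilon> by (intro mult_mono) (auto simp: \<delta>_def)
    also have "\<dots> = \<epsilon> / 4" using flux_sum_nonneg[of N] by (simp add: field_simps)
    finally show ?thesis .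
  qed
  have *: "\<bar>c v i - c u i\<bar> \<le> \<epsilon>" if "0 \<le> u" "u \<le> v" "v \<le> t + 1" "v - u < \<delta>" for u v
  proof -
    have "\<bar>c v i - c u i\<bar> \<le> 2 * ((v - u) * flux_sum N + tail_bound N (t + 1))"
      using that N by (intro c_increment) auto
    also have "\<dots> \<le> 2 * (\<delta> * flux_sum N + tail_bound N (t + 1))"
      using that flux_sum_nonneg[of N] by (intro mult_left_mono add_mono mult_right_mono) auto
    also have "\<dots> \<le> \<epsilon>" using \<delta>B N by simp
    finally show ?thesis .
  qed
  show "\<exists>d>0. \<forall>s\<in>{0..}. dist s t < d \<longrightarrow> dist (c s i) (c t i) \<le> \<epsilon>"
  proof (intro exI[of _ \<delta>] conjI ballI impI \<delta>)
    fix s assume s: "s \<in> {0..}" "dist s t < \<delta>"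
    show "dist (c s i) (c t i) \<le> \<epsilon>"
      using *[of s t] *[of t s] s t \<delta> by (cases "s \<le> t") (auto simp: dist_real_def abs_minus_commute)
  qed
qed

lemma flux_lim: "(\<lambda>n. flux (approx (\<sigma> n) s) e) \<longlonglongrightarrow> flux (c s) e"
  unfolding flux_def by (cases e) (auto intro!: tendsto_intros approx_lim)

lemma flux_c_nonneg: "e \<in> events \<Longrightarrow> 0 \<le> flux (c s) e"
  by (auto simp: flux_def events_def a_nonneg c_nonneg)

lemma flux_approx_measurable: "(\<lambda>s. flux (approx n s) e) \<in> borel_measurable lborel"
proof -
  have "(\<lambda>s. nat \<lfloor>s / step n\<rfloor>) \<in> measurable lborel (count_space UNIV)" by measurable
  then show ?thesis unfolding approx_def by (rule measurable_compose) simp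
qed

lemma flux_c_measurable: "(\<lambda>s. flux (c s) e) \<in> borel_measurable lborel"
  by (rule borel_measurable_LIMSEQ_real[OF flux_lim flux_approx_measurable])

definition limflux :: "real \<Rightarrow> nat \<times> nat \<times> nat \<Rightarrow> real" where
  "limflux t e = (\<integral>s. indicator {0<..<t} s *\<^sub>R flux (c s) e \<partial>lborel)"

text \<open>For a fixed event, \<open>cflux\<close> is the integral of a step function in time; it
  is dominated by \<open>flux_max e\<close> on the interval and converges pointwise.\<close>

lemma
  assumes t: "0 \<le> t" and e: "e \<in> events"
  shows flux_c_integrable: "integrable lborel (\<lambda>s. indicator {0<..<t} s *\<^sub>R flux (c s) e)"
    and cflux_lim: "(\<lambda>n. cflux (\<sigma> n) t e) \<longlonglongrightarrow> limflux t e"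
proof -
  define g where "g n l = (if e \<in> window (\<sigma> n) then flux (iter (\<sigma> n) l) e else 0)" for n l
  define m where "m n = nat \<lfloor>t / step (\<sigma> n)\<rfloor>" for n
  define w where "w n s = indicator {0..<step (\<sigma> n) * real (m n)} s * g n (nat \<lfloor>s / step (\<sigma> n)\<rfloor>)" for n s
  have w: "has_bochner_integral lborel (w n) (cflux (\<sigma> n) t e)" for n
    using has_bochner_integral_step[OF step_pos, of "\<sigma> n" "m n" "g n"]
    by (simp add: w_def[abs_def] cflux_def g_def m_def)
  have le_t: "step (\<sigma> n) * real (m n) \<le> t" for n
    unfolding m_def by (rule nat_floor_step_bounds[OF step_pos t])
  have m_lim: "(\<lambda>n. step (\<sigma> n) * real (m n)) \<longlonglongrightarrow> t"
  proof (rule tendsto_sandwich[OF _ _ _ tendsto_const])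
    show "(\<lambda>n. t - step (\<sigma> n)) \<longlonglongrightarrow> t" using tendsto_diff[OF tendsto_const step_lim] by simp
    show "\<forall>\<^sub>F n in sequentially. t - step (\<sigma> n) \<le> step (\<sigma> n) * real (m n)"
    proof (intro always_eventually allI)
      fix n
      show "t - step (\<sigma> n) \<le> step (\<sigma> n) * real (m n)"
        using nat_floor_step_bounds(2)[OF step_pos[of "\<sigma> n"] t] by (simp add: m_def)
    qed
  qed (use le_t in auto)
  \<comment> \<open>A strictly increasing index satisfies \<open>n \<le> \<sigma> n\<close>, so each
    fixed event eventually enters the window.\<close>
  have win: "\<forall>\<^sub>F n in sequentially. e \<in> window (\<sigma> n)"
  proof -
    obtain p r k where prk: "e = (p, r, k)" by (cases e)
    show ?thesis
    proof (intro eventually_sequentiallyI[of "Suc (p + r)"])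
      fix n assume "Suc (p + r) \<le> n"
      then have "Suc (p + r) \<le> \<sigma> n" using seq_suble[OF \<sigma>, of n] by linarith
      then show "e \<in> window (\<sigma> n)" using e prk by (auto simp: mem_window events_def)
    qed
  qed
  \<comment> \<open>At \<open>s = 0\<close> the step function may be nonzero while the open interval
    excludes the point; a single point is negligible.\<close>
  have ptw: "(\<lambda>n. w n s) \<longlonglongrightarrow> indicator {0<..<t} s *\<^sub>R flux (c s) e" if "s \<noteq> 0" for s
  proof (cases "s \<in> {0<..<t}")
    case True
    have "\<forall>\<^sub>F n in sequentially. flux (approx (\<sigma> n) s) e = w n s"
    proof -
      have "\<forall>\<^sub>F n in sequentially. s < step (\<sigma> n) * real (m n)"
        using order_tendstoD(1)[OF m_lim, of s] True by simp
      with win show ?thesis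
        by eventually_elim (use True in \<open>simp add: w_def g_def approx_def\<close>)
    qed
    from Lim_transform_eventually[OF flux_lim this] show ?thesis using True by simp
  next
    case False
    then have "w n s = 0" for n
      using le_t[of n] that by (auto simp: w_def indicator_def)
    then show ?thesis using False by simp
  qed
  have bnd: "AE s in lborel. norm (w n s) \<le> indicator {0..t} s * flux_max e" for n
  proof (intro AE_I2)
    fix s
    have "0 \<le> g n l \<and> g n l \<le> flux_max e" for l
      using flux_le_max[OF admissible_iter e] flux_max_nonneg[OF e] flux_nonneg[OF admissible_iter e]
      by (simp add: g_def)
    then show "norm (w n s) \<le> indicator {0..t} s * flux_max e"
      using le_t[of n] flux_max_nonneg[OF e] by (auto simp: w_def indicator_def)
  qed
  have dom: "integrable lborel (\<lambda>s. indicator {0..t} s * flux_max e)"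
    by (intro integrable_mult_left) (simp add: t)
  have AEptw: "AE s in lborel. (\<lambda>n. w n s) \<longlonglongrightarrow> indicator {0<..<t} s *\<^sub>R flux (c s) e"
    using AE_lborel_singleton[of 0] by eventually_elim (rule ptw)
  have meas: "(\<lambda>s. indicator {0<..<t} s *\<^sub>R flux (c s) e) \<in> borel_measurable lborel"
    using flux_c_measurable[of e] by measurable
  have wm: "w n \<in> borel_measurable lborel" for n
    using w[of n] by (intro borel_measurable_integrable) (simp add: has_bochner_integral_iff)
  show "integrable lborel (\<lambda>s. indicator {0<..<t} s *\<^sub>R flux (c s) e)"
    by (rule integrable_dominated_convergence[OF meas wm dom AEptw bnd])
  have "(\<lambda>n. integral\<^sup>L lborel (w n)) \<longlonglongrightarrow> limflux t e"
    unfolding limflux_def by (rule integral_dominated_convergence[OF meas wm dom AEptw bnd])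
  then show "(\<lambda>n. cflux (\<sigma> n) t e) \<longlonglongrightarrow> limflux t e"
    using w by (simp add: has_bochner_integral_iff)
qed

lemma limflux_nonneg: "e \<in> events \<Longrightarrow> 0 \<le> limflux t e"
  unfolding limflux_def by (intro integral_nonneg_AE AE_I2) (simp add: flux_c_nonneg)

lemma limflux_tail:
  assumes "2 \<le> N" "0 \<le> t" "finite A" "A \<subseteq> events - window N"
  shows "(\<Sum>e\<in>A. limflux t e) \<le> tail_bound N t"
proof (rule LIMSEQ_le_const2)
  show "(\<lambda>n. \<Sum>e\<in>A. cflux (\<sigma> n) t e) \<longlonglongrightarrow> (\<Sum>e\<in>A. limflux t e)"
    using assms by (intro tendsto_sum cflux_lim) auto
qed (use cflux_tail[of N t t A] assms in auto)

text \<open>Finite sums are split at \<open>window 2\<close>, the smallest window for which the tail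
  bound is available.\<close>

lemma limflux_summable:
  assumes "0 \<le> t"
  shows "limflux t summable_on events"
proof (rule nonneg_bdd_above_summable_on)
  show "bdd_above (sum (limflux t) ` {F. F \<subseteq> events \<and> finite F})"
  proof (rule bdd_aboveI2)
    fix F assume "F \<in> {F. F \<subseteq> events \<and> finite F}"
    then have F: "F \<subseteq> events" "finite F" by auto
    have "sum (limflux t) F = sum (limflux t) (F \<inter> window 2) + sum (limflux t) (F - window 2)"
      using F by (subst sum.union_disjoint[symmetric]) (auto intro!: sum.cong)
    also have "\<dots> \<le> sum (limflux t) (window 2) + tail_bound 2 t"
      using F assms limflux_nonneg subsetD[OF window_subset_events]
      by (intro add_mono sum_mono2 limflux_tail) auto
    finally show "sum (limflux t) F \<le> sum (limflux t) (window 2) + tail_bound 2 t" .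
  qed
qed (rule limflux_nonneg)

text \<open>In \<open>approx_eq\<close> the finitely many events of \<open>window N\<close> converge
  one by one, and the remaining ones are uniformly small both before and after the limit.\<close>

lemma c_eq:
  assumes t: "0 \<le> t"
  shows "c t i = cin i + infsum (\<lambda>e. gap (unit_at i) e * limflux t e) events"
proof -
  let ?G = "gap (unit_at i)"
  let ?S = "infsum (\<lambda>e. ?G e * limflux t e) events"
  have abs_summ: "(\<lambda>e. norm (?G e * limflux t e)) summable_on A" if "A \<subseteq> events" for A
  proof (rule summable_on_comparison_test)
    show "(\<lambda>e. 2 * limflux t e) summable_on A"
      using limflux_summable[OF t] that by (intro summable_on_cmult_right) (rule summable_on_subset_banach)
    show "norm (?G e * limflux t e) \<le> 2 * limflux t e" if "e \<in> A" for e
      using limflux_nonneg that \<open>A \<subseteq> events\<close> unfolding real_norm_def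
      by (intro abs_gap_unit_mult_le) blast
  qed auto
  have "(\<lambda>n. approx (\<sigma> n) t i) \<longlonglongrightarrow> cin i + ?S"
  proof (rule metric_LIMSEQ_I)
    fix \<epsilon> :: real assume \<epsilon>: "0 < \<epsilon>"
    \<comment> \<open>Each of the two tails is at most \<open>2 * tail_bound N t\<close>, so
      together they cost less than \<open>\<epsilon> / 2\<close>.\<close>
    obtain N where N: "2 \<le> N" "tail_bound N t < \<epsilon> / 8" using small_tail[of "\<epsilon> / 8"] \<epsilon> by auto
    have "?S = infsum (\<lambda>e. ?G e * limflux t e) (window N \<union> (events - window N))"
      using window_subset_events[of N] by (simp add: Un_absorb1)
    also have "\<dots> = (\<Sum>e\<in>window N. ?G e * limflux t e) + infsum (\<lambda>e. ?G e * limflux t e) (events - window N)"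
      using abs_summable_summable[OF abs_summ] by (subst infsum_Un_disjoint) auto
    finally have S: "?S = \<dots>" .
    have tailS: "\<bar>infsum (\<lambda>e. ?G e * limflux t e) (events - window N)\<bar> \<le> 2 * tail_bound N t"
    proof -
      have "norm (infsum (\<lambda>e. ?G e * limflux t e) (events - window N))
        \<le> infsum (\<lambda>e. norm (?G e * limflux t e)) (events - window N)"
        by (intro norm_infsum_bound abs_summ) auto
      also have "\<dots> \<le> 2 * tail_bound N t"
      proof (rule infsum_le_finite_sums[OF abs_summ])
        fix F assume F: "finite F" "F \<subseteq> events - window N"
        have "(\<Sum>e\<in>F. norm (?G e * limflux t e)) \<le> (\<Sum>e\<in>F. 2 * limflux t e)"
          using limflux_nonneg F unfolding real_norm_def by (intro sum_mono abs_gap_unit_mult_le) blast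
        also have "\<dots> \<le> 2 * tail_bound N t"
          unfolding sum_distrib_left[symmetric] using limflux_tail[OF N(1) t F] by simp
        finally show "(\<Sum>e\<in>F. norm (?G e * limflux t e)) \<le> 2 * tail_bound N t" .
      qed auto
      finally show ?thesis by simp
    qed
    have "(\<lambda>n. \<Sum>e\<in>window N. ?G e * cflux (\<sigma> n) t e) \<longlonglongrightarrow> (\<Sum>e\<in>window N. ?G e * limflux t e)"
      using t subsetD[OF window_subset_events] by (intro tendsto_intros cflux_lim) auto
    from metric_LIMSEQ_D[OF this, of "\<epsilon> / 2"] \<epsilon> obtain M where M: "\<And>n. M \<le> n \<Longrightarrow>
        \<bar>(\<Sum>e\<in>window N. ?G e * cflux (\<sigma> n) t e) - (\<Sum>e\<in>window N. ?G e * limflux t e)\<bar> < \<epsilon> / 2"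
      by (auto simp: dist_real_def)
    show "\<exists>M. \<forall>n\<ge>M. dist (approx (\<sigma> n) t i) (cin i + ?S) < \<epsilon>"
    proof (intro exI[of _ "max M N"] allI impI)
      fix n assume n: "max M N \<le> n"
      then have "N \<le> \<sigma> n" using seq_suble[OF \<sigma>, of n] by linarith
      then have sub: "window N \<subseteq> window (\<sigma> n)" by (rule window_mono)
      have "(\<Sum>e\<in>window (\<sigma> n). ?G e * cflux (\<sigma> n) t e) = (\<Sum>e\<in>window N. ?G e * cflux (\<sigma> n) t e)
          + (\<Sum>e\<in>window (\<sigma> n) - window N. ?G e * cflux (\<sigma> n) t e)"
        unfolding sum.subset_diff[OF sub finite_window] by (rule add.commute)
      moreover have "\<bar>\<Sum>e\<in>window (\<sigma> n) - window N. ?G e * cflux (\<sigma> n) t e\<bar> \<le> 2 * tail_bound N t"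
      proof -
        have "\<bar>\<Sum>e\<in>window (\<sigma> n) - window N. ?G e * cflux (\<sigma> n) t e\<bar>
          \<le> (\<Sum>e\<in>window (\<sigma> n) - window N. 2 * cflux (\<sigma> n) t e)"
          by (intro order.trans[OF sum_abs] sum_mono abs_gap_unit_mult_le cflux_nonneg)
        also have "\<dots> \<le> 2 * tail_bound N t"
          unfolding sum_distrib_left[symmetric]
          using cflux_tail[OF N(1) t order.refl, of "window (\<sigma> n) - window N" "\<sigma> n"]
            window_subset_events by auto
        finally show ?thesis .
      qed
      moreover have "\<bar>(\<Sum>e\<in>window N. ?G e * cflux (\<sigma> n) t e) - (\<Sum>e\<in>window N. ?G e * limflux t e)\<bar> < \<epsilon> / 2"
        using M n by simp
      ultimately show "dist (approx (\<sigma> n) t i) (cin i + ?S) < \<epsilon>"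
        using tailS N(2) unfolding dist_real_def approx_eq S by linarith
    qed
  qed
  then show ?thesis by (rule LIMSEQ_unique[OF approx_lim])
qed

end

section \<open>Identification with the four rate series\<close>

context dged_limit
begin

text \<open>The termwise integration lemmas on \<open>lborel\<close> restricted to the open
  interval, with the summable integrals \<open>limflux t\<close>.\<close>

lemma
  fixes g :: "nat \<Rightarrow> nat \<Rightarrow> nat \<times> nat \<times> nat"
  assumes t: "0 \<le> t" and E: "E \<subseteq> events"
    and inj: "inj_on (\<lambda>(k, j). g k j) (Sigma K L)" and img: "(\<lambda>(k, j). g k j) ` Sigma K L = E"
  shows AE_flux_summable: "AE s in lborel. s \<in> {0<..<t} \<longrightarrow> (\<lambda>(k, j). flux (c s) (g k j)) summable_on Sigma K L"
    and set_integrable_flux: "set_integrable lborel {0<..<t} (\<lambda>s. \<Sum>\<^sub>\<infinity>k\<in>K. \<Sum>\<^sub>\<infinity>j\<in>L k. flux (c s) (g k j))"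
    and set_integral_flux: "(LINT s:{0<..<t}|lborel. \<Sum>\<^sub>\<infinity>k\<in>K. \<Sum>\<^sub>\<infinity>j\<in>L k. flux (c s) (g k j)) = infsum (limflux t) E"
proof -
  let ?M = "restrict_space lborel {0<..<t}"
  have int: "integrable ?M (\<lambda>s. flux (c s) e)" if "e \<in> E" for e
    using flux_c_integrable[OF t, of e] that E by (subst integrable_restrict_space) auto
  have I: "integral\<^sup>L ?M (\<lambda>s. flux (c s) e) = limflux t e" for e
    by (subst integral_restrict_space) (auto simp: limflux_def)
  have nonneg: "0 \<le> flux (c s) e" if "e \<in> E" for s e
    using flux_c_nonneg that E by blast
  have summ: "(\<lambda>e. integral\<^sup>L ?M (\<lambda>s. flux (c s) e)) summable_on E"
    unfolding I using limflux_summable[OF t] E by (rule summable_on_subset_banach)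
  have "AE s in ?M. (\<lambda>(k, j). flux (c s) (g k j)) summable_on Sigma K L"
    by (rule AE_summable_on_Sigma[OF inj img int nonneg summ])
  then show "AE s in lborel. s \<in> {0<..<t} \<longrightarrow> (\<lambda>(k, j). flux (c s) (g k j)) summable_on Sigma K L"
    by (subst (asm) AE_restrict_space_iff) auto
  have "integrable ?M (\<lambda>s. \<Sum>\<^sub>\<infinity>k\<in>K. \<Sum>\<^sub>\<infinity>j\<in>L k. flux (c s) (g k j))"
    by (rule integrable_infsum_Sigma[OF inj img int nonneg summ])
  then show "set_integrable lborel {0<..<t} (\<lambda>s. \<Sum>\<^sub>\<infinity>k\<in>K. \<Sum>\<^sub>\<infinity>j\<in>L k. flux (c s) (g k j))"
    unfolding set_integrable_def by (subst (asm) integrable_restrict_space) auto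
  have "integral\<^sup>L ?M (\<lambda>s. \<Sum>\<^sub>\<infinity>k\<in>K. \<Sum>\<^sub>\<infinity>j\<in>L k. flux (c s) (g k j))
      = infsum (\<lambda>e. integral\<^sup>L ?M (\<lambda>s. flux (c s) e)) E"
    by (rule integral_infsum_Sigma[OF inj img int nonneg summ])
  then show "(LINT s:{0<..<t}|lborel. \<Sum>\<^sub>\<infinity>k\<in>K. \<Sum>\<^sub>\<infinity>j\<in>L k. flux (c s) (g k j)) = infsum (limflux t) E"
    unfolding set_lebesgue_integral_def I by (subst (asm) integral_restrict_space) auto
qed

text \<open>The finite sums over \<open>k\<close> in \<open>Q3\<close> and \<open>Q4\<close> are
  read as \<open>infsum\<close>, so that all four series have one form.\<close>

lemma Q_flux:
  "Q1 a i (c s) = (\<Sum>\<^sub>\<infinity>k\<in>{1..}. \<Sum>\<^sub>\<infinity>j\<in>UNIV. flux (c s) (i + k, j, k))"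
  "Q2 a i (c s) = - (\<Sum>\<^sub>\<infinity>k\<in>{1..}. \<Sum>\<^sub>\<infinity>j\<in>{k..}. flux (c s) (j, i, k))"
  "Q3 a i (c s) = (\<Sum>\<^sub>\<infinity>k\<in>{1..i}. \<Sum>\<^sub>\<infinity>j\<in>{k..}. flux (c s) (j, i - k, k))"
  "Q4 a i (c s) = - (\<Sum>\<^sub>\<infinity>k\<in>{1..i}. \<Sum>\<^sub>\<infinity>j\<in>UNIV. flux (c s) (i, j, k))"
  unfolding Q1_def Q2_def Q3_def Q4_def flux_def by (simp_all add: mult_ac)

text \<open>The four roles of size \<open>i\<close>, in the order of \<open>Q1\<close> to
  \<open>Q4\<close>: remainder of the donor, receiver, enlarged receiver, donor. For
  \<open>i = 0\<close> the last two sets are empty, matching the zero terms.\<close>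

lemma event_parametrizations:
  "inj_on (\<lambda>(k, j). (i + k, j, k)) ({1..} \<times> UNIV)"
  "(\<lambda>(k, j). (i + k, j, k)) ` ({1..} \<times> UNIV) = {(p, r, k) \<in> events. p - k = i}"
  "inj_on (\<lambda>(k, j). (j, i, k)) (SIGMA k:{1..}. {k..})"
  "(\<lambda>(k, j). (j, i, k)) ` (SIGMA k:{1..}. {k..}) = {(p, r, k) \<in> events. r = i}"
  "inj_on (\<lambda>(k, j). (j, i - k, k)) (SIGMA k:{1..i}. {k..})"
  "(\<lambda>(k, j). (j, i - k, k)) ` (SIGMA k:{1..i}. {k..}) = {(p, r, k) \<in> events. r + k = i}"
  "inj_on (\<lambda>(k, j). (i, j, k)) ({1..i} \<times> UNIV)"
  "(\<lambda>(k, j). (i, j, k)) ` ({1..i} \<times> UNIV) = {(p, r, k) \<in> events. p = i}"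
  by (auto simp: inj_on_def events_def image_iff)

text \<open>The coefficient \<open>gap (unit_at i)\<close> is a signed sum of four indicators. The
  event sets may overlap, so four extended families are added instead of splitting
  \<open>events\<close>.\<close>

lemma infsum_gap_limflux:
  assumes "0 \<le> t"
  shows "infsum (\<lambda>e. gap (unit_at i) e * limflux t e) events
    = infsum (limflux t) {(p, r, k) \<in> events. p - k = i} - infsum (limflux t) {(p, r, k) \<in> events. r = i}
      + infsum (limflux t) {(p, r, k) \<in> events. r + k = i} - infsum (limflux t) {(p, r, k) \<in> events. p = i}"
proof (rule infsumI)
  have *: "((\<lambda>e. of_bool (e \<in> E) * limflux t e) has_sum infsum (limflux t) E) events" if "E \<subseteq> events" for E
  proof -
    have "(limflux t has_sum infsum (limflux t) E) E"
      using limflux_summable[OF assms] that by (intro has_sum_infsum) (rule summable_on_subset_banach)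
    then show ?thesis
      by (rule has_sum_cong_neutral[THEN iffD1, rotated -1]) (use that in auto)
  qed
  let ?E1 = "{(p, r, k) \<in> events. p - k = i}" and ?E2 = "{(p, r, k) \<in> events. r = i}"
    and ?E3 = "{(p, r, k) \<in> events. r + k = i}" and ?E4 = "{(p, r, k) \<in> events. p = i}"
  have **: "((\<lambda>e. - (of_bool (e \<in> E) * limflux t e)) has_sum - infsum (limflux t) E) events" if "E \<subseteq> events" for E
    using *[OF that] by (simp add: has_sum_uminus)
  have "((\<lambda>e. of_bool (e \<in> ?E1) * limflux t e + - (of_bool (e \<in> ?E2) * limflux t e)
      + of_bool (e \<in> ?E3) * limflux t e + - (of_bool (e \<in> ?E4) * limflux t e))
    has_sum (infsum (limflux t) ?E1 + - infsum (limflux t) ?E2 + infsum (limflux t) ?E3 + - infsum (limflux t) ?E4)) events"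
    by (intro has_sum_add * **) auto
  then show "((\<lambda>e. gap (unit_at i) e * limflux t e)
    has_sum (infsum (limflux t) ?E1 - infsum (limflux t) ?E2 + infsum (limflux t) ?E3 - infsum (limflux t) ?E4)) events"
    unfolding diff_conv_add_uminus
    by (rule has_sum_cong[THEN iffD1, rotated]) (auto simp: gap.simps unit_at_def left_diff_distrib distrib_right)
qed

lemma is_mild_solution: "mild_solution a \<infinity> cin c"
  unfolding mild_solution_def
proof (intro conjI allI impI)
  show "c t \<in> X01_plus" for t by (rule c_X01_plus)
  show "continuous_on {t. 0 \<le> t \<and> ereal t < \<infinity>} (\<lambda>t. c t i)" for i
    using c_continuous by (simp add: atLeast_def)
next
  fix i :: nat and t :: real assume "0 < t \<and> ereal t < \<infinity>"
  then have t: "0 \<le> t" by simp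
  have sub: "{(p, r, k) \<in> events. p - k = i} \<subseteq> events" "{(p, r, k) \<in> events. r = i} \<subseteq> events"
    "{(p, r, k) \<in> events. r + k = i} \<subseteq> events" "{(p, r, k) \<in> events. p = i} \<subseteq> events" by auto
  note param = event_parametrizations[of i]
  note flow1 = t sub(1) param(1,2) and flow2 = t sub(2) param(3,4)
    and flow3 = t sub(3) param(5,6) and flow4 = t sub(4) param(7,8)
  show "AE s in lborel. s \<in> {0<..<t} \<longrightarrow> Q_converge a i (c s)"
    using AE_flux_summable[OF flow1] AE_flux_summable[OF flow2] AE_flux_summable[OF flow3]
      AE_flux_summable[OF flow4]
  proof eventually_elim
    case (elim s)
    show ?case
    proof
      assume s: "s \<in> {0<..<t}"
      \<comment> \<open>\<open>Q_converge\<close> asks for the third and fourth series one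
        \<open>k\<close> at a time; these are sections of the summable families of pairs.\<close>
      have "(\<lambda>j. flux (c s) (j, i - k, k)) summable_on {k..}" if "k \<in> {1..i}" for k
        using summable_on_SigmaD1[of "\<lambda>k j. flux (c s) (j, i - k, k)", OF _ that] elim(3) s by auto
      moreover have "(\<lambda>j. flux (c s) (i, j, k)) summable_on UNIV" if "k \<in> {1..i}" for k
        using summable_on_SigmaD1[of "\<lambda>k j. flux (c s) (i, j, k)", OF _ that] elim(4) s by auto
      ultimately show "Q_converge a i (c s)"
        using elim(1,2) s by (simp add: Q_converge_def flux_def mult_ac)
    qed
  qed
  have i1: "set_integrable lborel {0<..<t} (\<lambda>s. Q1 a i (c s))"
    unfolding Q_flux by (rule set_integrable_flux[OF flow1])
  have i2: "set_integrable lborel {0<..<t} (\<lambda>s. Q2 a i (c s))"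
    using integrable_minus[OF set_integrable_flux[OF flow2, unfolded set_integrable_def]]
    by (simp add: Q_flux set_integrable_def)
  have i3: "set_integrable lborel {0<..<t} (\<lambda>s. Q3 a i (c s))"
    unfolding Q_flux by (rule set_integrable_flux[OF flow3])
  have i4: "set_integrable lborel {0<..<t} (\<lambda>s. Q4 a i (c s))"
    using integrable_minus[OF set_integrable_flux[OF flow4, unfolded set_integrable_def]]
    by (simp add: Q_flux set_integrable_def)
  show "set_integrable lborel {0<..<t} (\<lambda>s. Q1 a i (c s))" "set_integrable lborel {0<..<t} (\<lambda>s. Q2 a i (c s))"
    "set_integrable lborel {0<..<t} (\<lambda>s. Q3 a i (c s))" "set_integrable lborel {0<..<t} (\<lambda>s. Q4 a i (c s))"
    by (fact i1 i2 i3 i4)+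
  have "(LINT s:{0<..<t}|lborel. Q1 a i (c s) + Q2 a i (c s) + Q3 a i (c s) + Q4 a i (c s))
    = (LINT s:{0<..<t}|lborel. Q1 a i (c s)) + (LINT s:{0<..<t}|lborel. Q2 a i (c s))
      + (LINT s:{0<..<t}|lborel. Q3 a i (c s)) + (LINT s:{0<..<t}|lborel. Q4 a i (c s))"
    using i1 i2 i3 i4 by (simp add: set_integral_add)
  also have "\<dots> = infsum (\<lambda>e. gap (unit_at i) e * limflux t e) events"
    unfolding infsum_gap_limflux[OF t] set_integral_flux[OF flow1, symmetric]
      set_integral_flux[OF flow2, symmetric] set_integral_flux[OF flow3, symmetric]
      set_integral_flux[OF flow4, symmetric] Q_flux
    by (simp add: set_lebesgue_integral_def)
  finally show "c t i = cin i + (LINT s:{0<..<t}|lborel.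
      Q1 a i (c s) + Q2 a i (c s) + Q3 a i (c s) + Q4 a i (c s))"
    using c_eq[OF t] by simp
qed

end

theorem theorem3p2:
  fixes a :: "nat \<Rightarrow> nat \<Rightarrow> nat \<Rightarrow> real"
    and q :: "nat \<Rightarrow> nat \<Rightarrow> real"
    and C Q :: real
    and cin :: "nat \<Rightarrow> real"
  assumes "rate_coefficients a"
    and "cin \<in> X01_plus"
    and "C \<ge> 1" and "Q \<ge> 1"
    and "\<And>i k. 1 \<le> k \<Longrightarrow> k \<le> i \<Longrightarrow> 0 \<le> q i k"
    and "\<And>i. 1 \<le> i \<Longrightarrow>
           (\<Sum>k=1..i. real k * real (i - k + 1) * q i k) \<le> Q * real i"
    and "\<And>i j k. 1 \<le> k \<Longrightarrow> k \<le> i \<Longrightarrow> 1 \<le> j \<Longrightarrow>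
           a i j k \<le> C * real (i - k + 1) * real (j + k) * q i k"
  shows "\<exists>c. mild_solution a \<infinity> cin c \<and> c 0 = cin"
proof -
  interpret dged a q C Q cin by unfold_locales (fact assms)+
  from approx_subseq obtain \<sigma> c
    where lim: "strict_mono \<sigma> \<and> (\<forall>t i. (\<lambda>n. approx (\<sigma> n) t i) \<longlonglongrightarrow> c t i)"
    by (elim exE)
  interpret dged_limit a q C Q cin \<sigma> c
    by unfold_locales (use lim in simp_all)
  show ?thesis by (intro exI[of _ c] conjI is_mild_solution c_0)
qed

end
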